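(* Let $\mathcal{C}=(F_v,F_e,\mathbb{Z}^d)$ be a crystal framework in $\mathbb{R}^d$ with $m=|F_e|$, $n=|F_v|$ and with rigidity operator $R$ from $\mathcal{K}_v^2$ to $\mathcal{K}_e^2$. (i) The motif $(F_v,F_e)$ determines a matrix-valued trigonometric function $\Phi:\mathbb{T}^d\to M_{m,dn}(\mathbb{C})$ (all entries trigonometric polynomials) for which there is a unitary equivalence $\mathcal{F}_e^{-1}R\,\mathcal{F}_v=M_\Phi$, where $M_\Phi:\mathbb{C}^{nd}\otimes L^2(\mathbb{T}^d)\to\mathbb{C}^m\otimes L^2(\mathbb{T}^d)$ is the operator of multiplication by $\Phi$. (ii) The framework $\mathcal{C}$ is square-summably rigid (resp. square-summably stress-free) if the column rank (resp. row rank) of $\Phi(z)$ is maximal, i.e. equal to $dn$ (resp. $m$), for almost every $z\in\mathbb{T}^d$.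
   Context: A crystal framework $\mathcal{C}=(F_v,F_e,\mathbb{Z}^d)$ in $\mathbb{R}^d$ is a connected countable bar-joint framework $(G,p)$, $G=(V,E)$ simple, edges of nonzero length, together with a discrete group of translations $T_n$ ($n\in\mathbb{Z}^d$, $T_nx=x+n_1a_1+\cdots+n_da_d$ with $a_1,\dots,a_d$ linearly independent), a finite connected set $F_e$ of framework edges and a finite set $F_v$ of framework vertices (contained in the vertex set of $F_e$), the pair being called a motif, such that the translates of $F_e$ (resp. $F_v$) under the $T_n$ are disjoint with union all framework edges (resp. vertices). The vertices are written $(\kappa,n)$, $\kappa\in F_v$, $n\in\mathbb{Z}^d$, with points $p_{\kappa,n}=T_np_\kappa$; edges are written $(e,n)$, $e\in F_e$. Let $\mathcal{K}_v^2=\ell^2(V)\otimes\mathbb{C}^d$ and $\mathcal{K}_e^2=\ell^2(E)$. The rigidity matrix $R=R(G,p)$ acts by $(Ru)_{e}=(p_v-p_w)\cdot(u_v-u_w)$ for each edge $e=vw$ (real bilinear dot product extended to $\mathbb{C}^d$); it defines a bounded operator $R:\mathcal{K}_v^2\to\mathcal{K}_e^2$, the rigidity operator. Let $\{\xi_{l,q}:1\le l\le dn,q\in\mathbb{Z}^d\}$ and $\{\eta_{k,q}:1\le k\le m,q\in\mathbb{Z}^d\}$ be the natural orthonormal bases of $\mathcal{K}_v^2$ and $\mathcal{K}_e^2$ ($l$ indexing pairs of a motif vertex and a coordinate direction, $k$ indexing motif edges, $q$ the translation index). $\mathcal{F}_v:\mathbb{C}^{dn}\otimes L^2(\mathbb{T}^d)\to\mathcal{K}_v^2$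 and $\mathcal{F}_e:\mathbb{C}^{m}\otimes L^2(\mathbb{T}^d)\to\mathcal{K}_e^2$ are the unitaries with $\xi_l\otimes z^q\leftrightarrow\xi_{l,q}$ and $\eta_k\otimes z^q\leftrightarrow\eta_{k,q}$. $\mathcal{C}$ is square-summably (infinitesimally) rigid if $\mathcal{K}_v^2\cap\ker R=\{0\}$, and square-summably stress-free if $\mathcal{K}_e^2\cap\ker R^t=\{0\}$, where $R^t$ is the transpose matrix. *)

theory Defs
  imports "HOL-Analysis.Analysis"
begin

section \<open>Crystal frameworks\<close>

text \<open>Graphs are given by a vertex set and a set of two-element edges.\<close>

definition connected_graph :: "'v set \<Rightarrow> 'v set set \<Rightarrow> bool" where
  "connected_graph V E \<longleftrightarrow>
     V \<noteq> {} \<and> (\<forall>v\<in>V. \<forall>w\<in>V. (v, w) \<in> {(x, y). {x, y} \<in> E}\<^sup>*)"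

locale bar_joint_framework =
  fixes V :: "'v set" and E :: "'v set set" and p :: "'v \<Rightarrow> real ^ 'd"
  assumes countable_vertices: "countable V"
    and simple_graph: "e \<in> E \<Longrightarrow> e \<subseteq> V \<and> card e = 2"
    and connected: "connected_graph V E"
    and nonzero_length: "{v, w} \<in> E \<Longrightarrow> p v \<noteq> p w"

text \<open>
  The vectors \<open>a i\<close> generate the translation group, and \<open>tr n\<close> is the translation \<open>T\<^sub>n\<close> acting on
  the labelled vertices of the framework. The joints \<open>p v\<close> are not required to be distinct; if they
  are, then \<open>tr\<close> is determined on \<open>V\<close> by \<open>tr_point\<close>, that is, by the translations of the ambient
  space. Values of \<open>tr n\<close> outside \<open>V\<close> are irrelevant.
\<close>

locale crystal_framework = bar_joint_framework V E p
  for V :: "'v set" and E :: "'v set set" and p :: "'v \<Rightarrow> real ^ 'd" +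
  fixes a :: "'d \<Rightarrow> real ^ 'd" and tr :: "int ^ 'd \<Rightarrow> 'v \<Rightarrow> 'v"
    and F\<^sub>v :: "'v set" and F\<^sub>e :: "'v set set"
  assumes periods: "inj a" "independent (range a)"
    and tr_vertex: "v \<in> V \<Longrightarrow> tr n v \<in> V"
    and tr_edge: "e \<in> E \<Longrightarrow> tr n ` e \<in> E"
    and tr_zero: "v \<in> V \<Longrightarrow> tr 0 v = v"
    and tr_add: "v \<in> V \<Longrightarrow> tr (n + n') v = tr n (tr n' v)"
    and tr_point: "v \<in> V \<Longrightarrow> p (tr n v) = p v + (\<Sum>i\<in>UNIV. real_of_int (n $ i) *\<^sub>R a i)"
    and motif_edges: "finite F\<^sub>e" "F\<^sub>e \<subseteq> E" "connected_graph (\<Union>F\<^sub>e) F\<^sub>e"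
    and motif_vertices: "finite F\<^sub>v" "F\<^sub>v \<subseteq> \<Union>F\<^sub>e"
    and vertex_translates: "disjoint_family (\<lambda>n. tr n ` F\<^sub>v)" "(\<Union>n. tr n ` F\<^sub>v) = V"
    and edge_translates: "disjoint_family (\<lambda>n. (`) (tr n) ` F\<^sub>e)" "(\<Union>n. (`) (tr n) ` F\<^sub>e) = E"

section \<open>The rigidity operator\<close>

text \<open>
  Elements of \<open>\<ell>\<^sup>2(S)\<close> are represented by functions vanishing outside \<open>S\<close>. The space
  \<open>\<ell>\<^sup>2(V) \<otimes> \<complex>\<^sup>d\<close> is taken to be \<open>ell2 (V \<times> UNIV)\<close>, so \<open>u (v, i)\<close> is the \<open>i\<close>-th coordinate of \<open>u\<^sub>v\<close>.
\<close>

definition ell2 :: "'s set \<Rightarrow> ('s \<Rightarrow> complex) set" where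
  "ell2 S = {u. (\<forall>s. s \<notin> S \<longrightarrow> u s = 0) \<and> (\<lambda>s. (norm (u s))\<^sup>2) summable_on S}"

definition rigidity_matrix ::
  "'v set set \<Rightarrow> ('v \<Rightarrow> real ^ 'd) \<Rightarrow> 'v set \<Rightarrow> 'v \<times> 'd \<Rightarrow> real" where
  "rigidity_matrix E p e = (\<lambda>(v, i).
     if e \<in> E \<and> v \<in> e then (p v - p (THE w. e = {v, w})) $ i else 0)"

text \<open>
  Row \<open>e\<close> of the rigidity matrix is supported on \<open>e \<times> UNIV\<close>, and the column of \<open>(v, i)\<close> on the
  edges incident with \<open>v\<close>, which are finite in number for a crystal framework (see below).
\<close>

definition rigidity_op ::
  "'v set set \<Rightarrow> ('v \<Rightarrow> real ^ 'd) \<Rightarrow> ('v \<times> 'd \<Rightarrow> complex) \<Rightarrow> 'v set \<Rightarrow> complex" where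
  "rigidity_op E p u e = (\<Sum>x\<in>e \<times> UNIV. of_real (rigidity_matrix E p e x) * u x)"

definition rigidity_op_transpose ::
  "'v set set \<Rightarrow> ('v \<Rightarrow> real ^ 'd) \<Rightarrow> ('v set \<Rightarrow> complex) \<Rightarrow> 'v \<times> 'd \<Rightarrow> complex" where
  "rigidity_op_transpose E p s x =
     (\<Sum>e | e \<in> E \<and> fst x \<in> e. of_real (rigidity_matrix E p e x) * s e)"

definition square_summably_rigid :: "'v set \<Rightarrow> 'v set set \<Rightarrow> ('v \<Rightarrow> real ^ 'd) \<Rightarrow> bool" where
  "square_summably_rigid V E p \<longleftrightarrow>
     ell2 (V \<times> UNIV) \<inter> {u. rigidity_op E p u = (\<lambda>_. 0)} = {\<lambda>_. 0}"

definition square_summably_stress_free :: "'v set set \<Rightarrow> ('v \<Rightarrow> real ^ 'd) \<Rightarrow> bool" where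
  "square_summably_stress_free E p \<longleftrightarrow>
     ell2 E \<inter> {s. rigidity_op_transpose E p s = (\<lambda>_. 0)} = {\<lambda>_. 0}"

lemma rigidity_op_edge:
  assumes "{v, w} \<in> E" "v \<noteq> w"
  shows "rigidity_op E p u {v, w} =
    (\<Sum>i\<in>UNIV. of_real ((p v - p w) $ i) * (u (v, i) - u (w, i)))"
proof -
  have vw: "(THE x. {v, w} = {v, x}) = w" "(THE x. {v, w} = {w, x}) = v"
    using assms(2) by (auto simp: doubleton_eq_iff)
  have "rigidity_op E p u {v, w} =
      (\<Sum>x\<in>{v, w}. \<Sum>i\<in>UNIV. of_real (rigidity_matrix E p {v, w} (x, i)) * u (x, i))"
    unfolding rigidity_op_def by (subst sum.cartesian_product) (simp add: case_prod_unfold)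
  also have "\<dots> = (\<Sum>i\<in>UNIV. of_real ((p v - p w) $ i) * u (v, i)) +
      (\<Sum>i\<in>UNIV. of_real ((p w - p v) $ i) * u (w, i))"
    using assms by (simp add: rigidity_matrix_def vw)
  also have "\<dots> = (\<Sum>i\<in>UNIV. of_real ((p v - p w) $ i) * (u (v, i) - u (w, i)))"
    by (simp add: algebra_simps flip: sum.distrib)
  finally show ?thesis .
qed

lemma (in crystal_framework) finite_incident_edges:
  assumes "v \<in> V"
  shows "finite {e \<in> E. v \<in> e}"
proof -
  define Q where "Q x = {n. tr n x = v}" for x
  have fin_Q: "finite (Q x)" if "x \<in> V" for x
  proof -
    have "n = n'" if "n \<in> Q x" "n' \<in> Q x" for n n'
    proof -
      have lin: "\<forall>c. (\<Sum>y\<in>range a. c y *\<^sub>R y) = 0 \<longrightarrow> (\<forall>y\<in>range a. c y = 0)"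
        using independent_explicit[of "range a"] periods by simp
      have "p (tr n x) = p (tr n' x)" using that by (simp add: Q_def)
      then have "(\<Sum>i\<in>UNIV. (real_of_int (n $ i) - real_of_int (n' $ i)) *\<^sub>R a i) = 0"
        using \<open>x \<in> V\<close> by (simp add: tr_point algebra_simps sum_subtractf)
      then have "(\<Sum>y\<in>range a. (real_of_int (n $ inv a y) - real_of_int (n' $ inv a y)) *\<^sub>R y) = 0"
        by (subst sum.reindex[OF periods(1)]) (simp add: periods(1))
      from lin[rule_format, OF this] have "n $ inv a (a i) = n' $ inv a (a i)" for i
        by simp
      then show "n = n'" by (simp add: vec_eq_iff periods(1))
    qed
    then have "Q x = {} \<or> (\<exists>n. Q x = {n})" by blast
    then show ?thesis by auto
  qed
  have fin_edge: "finite f" and sub_V: "f \<subseteq> V" if "f \<in> F\<^sub>e" for f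
    using simple_graph[of f] motif_edges(2) that card_ge_0_finite[of f] by auto
  have "finite (\<Union>f\<in>F\<^sub>e. \<Union>x\<in>f. (\<lambda>n. tr n ` f) ` Q x)"
    by (intro finite_UN_I finite_imageI motif_edges(1) fin_edge fin_Q subsetD[OF sub_V])
  moreover have "{e \<in> E. v \<in> e} \<subseteq> (\<Union>f\<in>F\<^sub>e. \<Union>x\<in>f. (\<lambda>n. tr n ` f) ` Q x)"
    unfolding edge_translates(2)[symmetric] Q_def by blast
  ultimately show ?thesis by (rule rev_finite_subset)
qed

section \<open>Square-integrable functions on the torus\<close>

definition torus :: "(complex ^ 'd) set" where
  "torus = {z. \<forall>i. norm (z $ i) = 1}"

text \<open>Normalised Haar measure: the image of Lebesgue measure on the unit cube.\<close>

definition haar_torus :: "(complex ^ 'd) measure" where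
  "haar_torus = distr (restrict_space lborel (cbox 0 1)) (restrict_space borel torus)
     (\<lambda>t :: real ^ 'd. \<chi> i. cis (2 * pi * t $ i))"

definition mpowi :: "complex ^ 'd \<Rightarrow> int ^ 'd \<Rightarrow> complex" where
  "mpowi z q = (\<Prod>i\<in>UNIV. z $ i powi q $ i)"

definition trig_polynomial :: "(complex ^ 'd \<Rightarrow> complex) \<Rightarrow> bool" where
  "trig_polynomial f \<longleftrightarrow>
     (\<exists>Q c. finite Q \<and> (\<forall>z\<in>torus. f z = (\<Sum>q\<in>Q. c q * mpowi z q)))"

text \<open>
  \<open>\<complex>\<^sup>k \<otimes> L\<^sup>2(T\<^sup>d)\<close> as a set of square-integrable vector-valued functions; two functions represent
  the same element if they agree almost everywhere.
\<close>

definition L2_torus :: "(complex ^ 'd \<Rightarrow> complex ^ 'k) set" where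
  "L2_torus = {f \<in> borel_measurable haar_torus. integrable haar_torus (\<lambda>z. (norm (f z))\<^sup>2)}"

text \<open>
  The last two clauses make \<open>F\<close> isometric and onto; in particular \<open>F f = F g\<close> exactly if \<open>f = g\<close>
  almost everywhere, so that \<open>F\<close> descends to a bijection of the space of classes onto \<open>ell2 S\<close>.
\<close>

definition unitary_L2_ell2 ::
  "((complex ^ 'd \<Rightarrow> complex ^ 'k) \<Rightarrow> 's \<Rightarrow> complex) \<Rightarrow> 's set \<Rightarrow> bool" where
  "unitary_L2_ell2 F S \<longleftrightarrow>
     (\<forall>f\<in>L2_torus. F f \<in> ell2 S) \<and>
     (\<forall>f\<in>L2_torus. \<forall>g\<in>L2_torus. \<forall>c. F (\<lambda>z. c *s f z + g z) = (\<lambda>s. c * F f s + F g s)) \<and>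
     (\<forall>f\<in>L2_torus. (\<Sum>\<^sub>\<infinity>s\<in>S. (norm (F f s))\<^sup>2) = (\<integral>z. (norm (f z))\<^sup>2 \<partial>haar_torus)) \<and>
     (\<forall>u\<in>ell2 S. \<exists>f\<in>L2_torus. F f = u)"

text \<open>
  For an injective labelling \<open>lab\<close>, the sum has at most one term, so the value at \<open>lab k q\<close> is the
  Fourier coefficient of index \<open>q\<close> of the \<open>k\<close>-th coordinate of \<open>f\<close>.
\<close>

definition fourier_map ::
  "('k \<Rightarrow> int ^ 'd \<Rightarrow> 's) \<Rightarrow> (complex ^ 'd \<Rightarrow> complex ^ 'k) \<Rightarrow> 's \<Rightarrow> complex" where
  "fourier_map lab f s =
     (\<Sum>(k, q) | lab k q = s. \<integral>z. f z $ k * mpowi z (- q) \<partial>haar_torus)"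

definition maps_basis ::
  "('k \<Rightarrow> int ^ 'd \<Rightarrow> 's) \<Rightarrow> ((complex ^ 'd \<Rightarrow> complex ^ 'k) \<Rightarrow> 's \<Rightarrow> complex) \<Rightarrow> bool" where
  "maps_basis lab F \<longleftrightarrow>
     (\<forall>k q. F (\<lambda>z. axis k (mpowi z q)) = (\<lambda>s. if s = lab k q then 1 else 0))"

section \<open>The symbol function of a motif\<close>

text \<open>
  The motif is enumerated by \<open>\<kappa> :: 'n \<Rightarrow> 'v\<close> and \<open>\<epsilon> :: 'm \<Rightarrow> 'v set\<close>. The vertex \<open>tr q (\<kappa> l)\<close> is
  the one written \<open>(\<kappa>\<^sub>l, q)\<close>.
\<close>

definition vertex_label ::
  "(int ^ 'd \<Rightarrow> 'v \<Rightarrow> 'v) \<Rightarrow> ('n \<Rightarrow> 'v) \<Rightarrow> 'n \<times> 'd \<Rightarrow> int ^ 'd \<Rightarrow> 'v \<times> 'd" where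
  "vertex_label tr \<kappa> = (\<lambda>(l, i) q. (tr q (\<kappa> l), i))"

definition edge_label ::
  "(int ^ 'd \<Rightarrow> 'v \<Rightarrow> 'v) \<Rightarrow> ('m \<Rightarrow> 'v set) \<Rightarrow> 'm \<Rightarrow> int ^ 'd \<Rightarrow> 'v set" where
  "edge_label tr \<epsilon> = (\<lambda>k q. tr q ` \<epsilon> k)"

text \<open>
  The endpoints of the motif edge \<open>\<epsilon> k\<close> are of the form \<open>tr q (\<kappa> l)\<close>; each contributes its
  coefficient in the rigidity matrix times \<open>z\<^sup>-\<^sup>q\<close>, the complex conjugate of \<open>z\<^sup>q\<close> on the torus.
\<close>

definition symbol_function ::
  "'v set set \<Rightarrow> ('v \<Rightarrow> real ^ 'd) \<Rightarrow> (int ^ 'd \<Rightarrow> 'v \<Rightarrow> 'v) \<Rightarrow> ('n::finite \<Rightarrow> 'v) \<Rightarrow>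
     ('m::finite \<Rightarrow> 'v set) \<Rightarrow> complex ^ 'd \<Rightarrow> complex ^ ('n \<times> 'd) ^ 'm" where
  "symbol_function F\<^sub>e p tr \<kappa> \<epsilon> z = (\<chi> k j.
     \<Sum>q | tr q (\<kappa> (fst j)) \<in> \<epsilon> k.
       of_real (rigidity_matrix F\<^sub>e p (\<epsilon> k) (vertex_label tr \<kappa> j q)) * mpowi z (- q))"

definition mult_op ::
  "(complex ^ 'd \<Rightarrow> complex ^ 'k ^ 'm) \<Rightarrow> (complex ^ 'd \<Rightarrow> complex ^ 'k) \<Rightarrow> complex ^ 'd \<Rightarrow> complex ^ 'm"
  where "mult_op \<Phi> f = (\<lambda>z. \<Phi> z *v f z)"

definition column_rank :: "'a::field ^ 'k ^ 'm \<Rightarrow> nat" where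
  "column_rank A = vec.dim (columns A)"

definition row_rank :: "'a::field ^ 'k ^ 'm \<Rightarrow> nat" where
  "row_rank A = vec.dim (rows A)"

end

theory Submission
  imports Defs
begin

text \<open>
  Translating a vertex or an edge of a crystal framework does not change the differences of joints
  that make up the rigidity matrix. In the labels \<open>(\<kappa>, q)\<close> and \<open>(e, q)\<close> the rigidity operator is
  therefore a convolution over \<open>\<int>\<^sup>d\<close> with a finitely supported, matrix-valued kernel: if the motif edge
  \<open>e\<close> has an endpoint \<open>(\<kappa>, r)\<close>, then its translate \<open>(e, q)\<close> has the endpoint \<open>(\<kappa>, q + r)\<close>, with the same
  coefficient (\<open>rigidity_op_edge_label\<close>). The Fourier transform turns convolution into multiplication,
  here by the matrix \<open>\<Phi>(z)\<close> with one term \<open>z\<^sup>-\<^sup>r\<close> for every endpoint (\<open>fourier_map_symbol_function\<close>).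
  The sign appears because the coefficient of \<open>z\<^sup>-\<^sup>r f\<close> at \<open>q\<close> is that of \<open>f\<close> at \<open>q + r\<close>. In the same way
  the transpose of the rigidity matrix becomes multiplication by the conjugate transpose of \<open>\<Phi>\<close>
  (\<open>fourier_map_adjoint_symbol\<close>).

  The analytic content is that the Fourier transform of \<open>L\<^sup>2(T\<^sup>d)\<close> is unitary onto \<open>\<ell>\<^sup>2(\<int>\<^sup>d)\<close>. Orthonormality
  of the characters follows from Fubini's theorem (\<open>integral_mpowi\<close>) and gives Bessel's inequality.
  An integrable function whose Fourier coefficients all vanish is zero almost everywhere
  (\<open>AE_eq_0_if_fourier_coeffs_eq_0\<close>): by the Stone-Weierstrass theorem it integrates to zero against
  every continuous function, hence over every closed set, hence over every Borel set. Conversely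
  every square-summable family of coefficients comes from a function of no larger norm
  (\<open>riesz_fischer\<close>). Parseval's identity follows: the function that Riesz-Fischer
  recovers from the coefficients of \<open>f\<close> equals \<open>f\<close> almost everywhere, so the norm of \<open>f\<close> is at most
  that of its coefficients, and Bessel's inequality is the converse.

  Once both operators are multiplication operators, a square-summable flex or stress is the
  transform of some \<open>f\<close> for which \<open>\<Phi>(z) f(z)\<close>, or \<open>\<Phi>(z)\<^sup>* f(z)\<close>, vanishes for almost every \<open>z\<close>.
  Where the column rank, or the row rank, of \<open>\<Phi>(z)\<close> is maximal, linear algebra gives \<open>f(z) = 0\<close>.
\<close>

section \<open>Haar measure on the torus and its characters\<close>

lemma closed_torus: "closed (torus :: (complex ^ 'd) set)"
proof -
  have *: "torus = (\<Inter>i. {z :: complex ^ 'd. norm (z $ i) = 1})"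
    by (auto simp: torus_def)
  moreover have "closed {z :: complex ^ 'd. norm (z $ i) = 1}" for i
    by (intro closed_Collect_eq continuous_intros)
  ultimately show ?thesis unfolding * by (intro closed_INT ballI)
qed

lemma torus_component_nonzero: "z \<in> torus \<Longrightarrow> z $ i \<noteq> 0"
proof
  assume "z \<in> torus" "z $ i = 0"
  then have "norm (0 :: complex) = 1" by (metis (mono_tags) mem_Collect_eq torus_def)
  then show False by simp
qed

lemma prod_Basis_cart: "(\<Prod>b\<in>(Basis :: (real ^ 'd) set). f b) = (\<Prod>i\<in>UNIV. f (axis i 1))"
proof -
  have "(Basis :: (real ^ 'd) set) = range (\<lambda>i. axis i 1)"
    by (auto simp: Basis_vec_def)
  moreover have "inj (\<lambda>i. axis i 1 :: real ^ 'd)"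
    by (auto simp: inj_def axis_eq_axis)
  ultimately show ?thesis by (metis (no_types, lifting) prod.reindex_cong)
qed

lemma compact_torus: "compact (torus :: (complex ^ 'd) set)"
proof -
  have "norm z \<le> real CARD('d)" if "z \<in> torus" for z :: "complex ^ 'd"
  proof -
    have "norm z \<le> (\<Sum>i\<in>UNIV. norm (z $ i))"
      unfolding norm_vec_def by (rule L2_set_le_sum) auto
    then show ?thesis using that by (simp add: torus_def)
  qed
  then have "bounded (torus :: (complex ^ 'd) set)"
    by (meson bounded_iff)
  with closed_torus show ?thesis by (simp add: compact_eq_bounded_closed)
qed

lemma space_haar_torus [simp]: "space (haar_torus :: (complex ^ 'd) measure) = torus"
  by (simp add: haar_torus_def space_restrict_space)

lemma sets_haar_torus [measurable_cong]:
  "sets (haar_torus :: (complex ^ 'd) measure) = sets (restrict_space borel torus)"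
  by (simp add: haar_torus_def)

lemma measurable_torus_parametrisation:
  "(\<lambda>t :: real ^ 'd. \<chi> i. cis (2 * pi * t $ i))
     \<in> restrict_space lborel (cbox 0 1) \<rightarrow>\<^sub>M restrict_space borel torus"
proof (rule measurable_restrict_space2)
  have "continuous_on UNIV (\<lambda>t :: real ^ 'd. \<chi> i. cis (2 * pi * t $ i))"
    by (intro continuous_intros)
  then have "(\<lambda>t :: real ^ 'd. \<chi> i. cis (2 * pi * t $ i)) \<in> borel_measurable lborel"
    by (simp add: borel_measurable_continuous_onI)
  then show "(\<lambda>t :: real ^ 'd. \<chi> i. cis (2 * pi * t $ i))
     \<in> borel_measurable (restrict_space lborel (cbox 0 1))"
    by (rule measurable_restrict_space1)
qed (auto simp: torus_def)

lemma emeasure_haar_torus: "emeasure haar_torus (torus :: (complex ^ 'd) set) = 1"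
proof -
  let ?f = "\<lambda>t :: real ^ 'd. \<chi> i. cis (2 * pi * t $ i)"
  have "emeasure haar_torus (torus :: (complex ^ 'd) set) =
      emeasure (restrict_space lborel (cbox 0 1)) (?f -` torus \<inter> cbox (0 :: real ^ 'd) 1)"
    unfolding haar_torus_def
    by (subst emeasure_distr[OF measurable_torus_parametrisation])
       (auto simp: space_restrict_space sets_restrict_space)
  also have "?f -` torus \<inter> cbox (0 :: real ^ 'd) 1 = cbox 0 1"
    by (auto simp: torus_def)
  also have "emeasure (restrict_space lborel (cbox 0 1)) (cbox (0 :: real ^ 'd) 1) =
      emeasure lborel (cbox (0 :: real ^ 'd) 1)"
    by (subst emeasure_restrict_space) auto
  also have "\<dots> = 1"
    by (subst emeasure_lborel_cbox) (simp_all only: prod_Basis_cart, auto simp: Basis_vec_def inner_axis)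
  finally show ?thesis .
qed

interpretation haar: finite_measure "haar_torus :: (complex ^ 'd) measure"
  by (rule finite_measureI) (simp add: emeasure_haar_torus)

lemma measure_haar_torus [simp]: "measure haar_torus (torus :: (complex ^ 'd) set) = 1"
  by (simp add: measure_def emeasure_haar_torus)

lemma borel_measurable_haar_torusI:
  fixes f :: "complex ^ 'd \<Rightarrow> 'b::topological_space"
  shows "continuous_on torus f \<Longrightarrow> f \<in> borel_measurable haar_torus"
  using borel_measurable_continuous_on_restrict[of torus f] 
  by (simp cong: measurable_cong_sets add: sets_haar_torus)

lemma mpowi_add: "z \<in> torus \<Longrightarrow> mpowi z (q + r) = mpowi z q * mpowi z r"
  unfolding mpowi_def prod.distrib[symmetric]
  by (intro prod.cong refl, simp, subst power_int_add) (auto simp: torus_component_nonzero)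

lemma mpowi_0 [simp]: "mpowi z 0 = 1"
  by (simp add: mpowi_def)

lemma norm_mpowi [simp]: "z \<in> torus \<Longrightarrow> norm (mpowi z q) = 1"
  by (simp add: mpowi_def torus_def norm_power_int flip: prod_norm)

lemma cnj_mpowi: "z \<in> torus \<Longrightarrow> cnj (mpowi z q) = mpowi z (- q)"
proof -
  assume z: "z \<in> torus"
  have "mpowi z q * mpowi z (- q) = 1"
    using mpowi_add[OF z, of q "- q"] by simp
  moreover have "cnj (mpowi z q) * mpowi z q = 1"
    using norm_mpowi[OF z, of q] complex_norm_square[of "mpowi z q"] by (simp add: mult.commute)
  ultimately show ?thesis
    by (metis mult.assoc mult.left_neutral mult.right_neutral)
qed

lemma continuous_on_mpowi [continuous_intros]: "continuous_on torus (\<lambda>z. mpowi z q)"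
  unfolding mpowi_def by (intro continuous_intros) (auto simp: torus_component_nonzero)

lemma borel_measurable_mpowi [measurable]: "(\<lambda>z. mpowi z q) \<in> borel_measurable haar_torus"
  by (intro borel_measurable_haar_torusI continuous_intros)

text \<open>
  The antiderivative of \<open>exp (c t)\<close> is \<open>exp (c t) / c\<close>, and for \<open>c = 2 \<pi> \<i> n\<close> it takes the same value at
  both ends of the unit interval.
\<close>

lemma integral_unit_interval_cis:
  fixes n :: int
  shows "(\<integral>t. indicator {0..1} t *\<^sub>R cis (2 * pi * (of_int n * t)) \<partial>lborel) =
    (if n = 0 then 1 else 0)"
    and "integrable lborel (\<lambda>t. indicator {0..1} t *\<^sub>R cis (2 * pi * (of_int n * t)))"
proof -
  show "integrable lborel (\<lambda>t. indicator {0..1} t *\<^sub>R cis (2 * pi * (of_int n * t)))"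
    by (rule borel_integrable_compact) (auto intro!: continuous_intros)
  show "(\<integral>t. indicator {0..1} t *\<^sub>R cis (2 * pi * (of_int n * t)) \<partial>lborel) =
    (if n = 0 then 1 else 0)"
  proof (cases "n = 0")
    case False
    define c where "c = \<i> * (2 * of_real pi * of_int n)"
    have c: "c \<noteq> 0" using False by (simp add: c_def)
    have cis: "cis (2 * pi * (of_int n * t)) = exp (c * of_real t)" for t
      by (simp add: c_def cis_conv_exp mult_ac)
    have "((\<lambda>t. exp (c * of_real t) / c) has_vector_derivative exp (c * of_real t)) (at t within {0..1})" for t
      using c by (intro has_vector_derivative_real_field) (auto intro!: derivative_eq_intros)
    then have "(\<integral>t. indicator {0..1} t *\<^sub>R exp (c * of_real t) \<partial>lborel) =
        exp (c * of_real 1) / c - exp (c * of_real 0) / c"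
      by (intro integral_FTC_Icc) (auto intro!: continuous_intros)
    also have "exp (c * of_real 1) = exp (c * of_real 0)"
      using cis_multiple_2pi[of "of_int n"] cis[of 1] by simp
    finally show ?thesis unfolding cis using False by simp
  next
    case True
    have "(\<integral>t. indicator {0..1::real} t *\<^sub>R (1 :: complex) \<partial>lborel) = 1"
      by simp
    then show ?thesis using True by simp
  qed
qed

text \<open>
  In the parameters \<open>t\<close> the character \<open>z\<^sup>q\<close> is a product of functions of one variable each, so that
  Fubini's theorem reduces the integral to the one-dimensional case.
\<close>

lemma integral_mpowi:
  fixes q :: "int ^ 'd"
  shows "(\<integral>z. mpowi z q \<partial>haar_torus) = (if q = 0 then 1 else 0)"
proof -
  define h where "h b t = indicator {0..1} t *\<^sub>R cis (2 * pi * (of_int (q $ (axis_index b)) * t))"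
    for b :: "real ^ 'd" and t :: real
  interpret product_sigma_finite "\<lambda>_ :: real ^ 'd. lborel :: real measure" ..
  have h: "integrable lborel (h b)" "integral\<^sup>L lborel (h b) = (if q $ axis_index b = 0 then 1 else 0)" for b
    unfolding h_def using integral_unit_interval_cis by auto
  have [measurable]: "h b \<in> borel_measurable borel" for b
    using h(1)[of b] borel_measurable_integrable by force
  have "(\<integral>z. mpowi z q \<partial>haar_torus) =
      (\<integral>t. mpowi (\<chi> i. cis (2 * pi * t $ i)) q \<partial>restrict_space lborel (cbox (0 :: real ^ 'd) 1))"
    unfolding haar_torus_def
    by (rule integral_distr[OF measurable_torus_parametrisation])
       (use borel_measurable_mpowi[of q] in \<open>simp cong: measurable_cong_sets add: sets_haar_torus\<close>)
  also have "\<dots> = (\<integral>t. indicator (cbox (0 :: real ^ 'd) 1) t *\<^sub>R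
      mpowi (\<chi> i. cis (2 * pi * t $ i)) q \<partial>lborel)"
    by (subst integral_restrict_space) auto
  also have "\<dots> = (\<integral>t. (\<Prod>b\<in>Basis. h b (t \<bullet> b)) \<partial>lborel)"
  proof (rule Bochner_Integration.integral_cong[OF refl])
    fix t :: "real ^ 'd"
    have "(\<Prod>b\<in>Basis. h b (t \<bullet> b)) = (\<Prod>i\<in>UNIV. h (axis i 1) (t $ i))"
      by (simp add: prod_Basis_cart inner_axis)
    also have "\<dots> = (\<Prod>i\<in>UNIV. (if t $ i \<in> {0..1} then 1 else 0) * cis (2 * pi * t $ i) powi q $ i)"
      by (intro prod.cong refl) (simp add: h_def axis_index_axis cis_power_int mult_ac)
    also have "\<dots> = indicator (cbox 0 1) t *\<^sub>R mpowi (\<chi> i. cis (2 * pi * t $ i)) q"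
      by (auto simp: mpowi_def prod.distrib mem_box_cart indicator_def not_le intro!: prod_zero)
    finally show "indicator (cbox 0 1) t *\<^sub>R mpowi (\<chi> i. cis (2 * pi * t $ i)) q =
      (\<Prod>b\<in>Basis. h b (t \<bullet> b))" by simp
  qed
  also have "\<dots> = (\<integral>x. (\<Prod>b\<in>Basis. h b (x b)) \<partial>(\<Pi>\<^sub>M b\<in>(Basis :: (real ^ 'd) set). lborel))"
    by (subst lborel_eq, subst integral_distr) (auto simp: inner_sum_left inner_Basis if_distrib cong: if_cong)
  also have "\<dots> = (\<Prod>b\<in>(Basis :: (real ^ 'd) set). if q $ axis_index b = 0 then 1 else 0)"
    by (subst product_integral_prod) (auto simp: h)
  also have "\<dots> = (\<Prod>i\<in>UNIV. if q $ i = 0 then 1 else 0)"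
    by (simp add: prod_Basis_cart axis_index_axis)
  also have "\<dots> = (if q = 0 then 1 else 0)"
    by (auto simp: vec_eq_iff)
  finally show ?thesis .
qed

section \<open>Fourier coefficients determine an integrable function\<close>

text \<open>
  The exponents \<open>g i\<close> need not be distinct: terms with the same exponent are collected. This makes
  products, and the sums that define the symbol function, trigonometric polynomials at once.
\<close>

lemma trig_polynomialI:
  fixes f :: "complex ^ 'd \<Rightarrow> complex"
  assumes "finite I" "\<And>z. z \<in> torus \<Longrightarrow> f z = (\<Sum>i\<in>I. b i * mpowi z (g i))"
  shows "trig_polynomial f"
  unfolding trig_polynomial_def
proof (intro exI conjI ballI)
  show "finite (g ` I)" using assms(1) by simp
  fix z :: "complex ^ 'd" assume z: "z \<in> torus"
  have "f z = (\<Sum>q\<in>g ` I. \<Sum>i | i \<in> I \<and> g i = q. b i * mpowi z (g i))"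
    unfolding assms(2)[OF z] by (rule sum.image_gen[OF assms(1)])
  also have "\<dots> = (\<Sum>q\<in>g ` I. (\<Sum>i | i \<in> I \<and> g i = q. b i) * mpowi z q)"
    by (intro sum.cong refl) (simp add: sum_distrib_right)
  finally show "f z = (\<Sum>q\<in>g ` I. (\<Sum>i | i \<in> I \<and> g i = q. b i) * mpowi z q)" .
qed

lemma trig_polynomial_const: "trig_polynomial (\<lambda>_. c)"
  by (rule trig_polynomialI[of "{()}" _ "\<lambda>_. c" "\<lambda>_. 0"]) auto

lemma trig_polynomial_mult:
  assumes "trig_polynomial f" "trig_polynomial g"
  shows "trig_polynomial (\<lambda>z. f z * g z)"
proof -
  obtain P a Q b where "finite P" "finite Q"
    and f: "\<And>z. z \<in> torus \<Longrightarrow> f z = (\<Sum>q\<in>P. a q * mpowi z q)"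
    and g: "\<And>z. z \<in> torus \<Longrightarrow> g z = (\<Sum>q\<in>Q. b q * mpowi z q)"
    using assms unfolding trig_polynomial_def by metis
  then show ?thesis
    by (intro trig_polynomialI[of "P \<times> Q" _ "\<lambda>(q, r). a q * b r" "\<lambda>(q, r). q + r"])
       (auto simp: sum_product sum.cartesian_product case_prod_unfold mpowi_add mult_ac intro!: sum.cong)
qed

lemma trig_polynomial_add:
  assumes "trig_polynomial f" "trig_polynomial g"
  shows "trig_polynomial (\<lambda>z. f z + g z)"
proof -
  obtain P a Q b where "finite P" "finite Q"
    and f: "\<And>z. z \<in> torus \<Longrightarrow> f z = (\<Sum>q\<in>P. a q * mpowi z q)"
    and g: "\<And>z. z \<in> torus \<Longrightarrow> g z = (\<Sum>q\<in>Q. b q * mpowi z q)"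
    using assms unfolding trig_polynomial_def by metis
  then show ?thesis
    by (intro trig_polynomialI[of "P <+> Q" _ "case_sum a b" "case_sum id id"])
       (auto simp: sum.Plus)
qed

lemma trig_polynomial_component:
  fixes i :: "'d::finite"
  shows "trig_polynomial (\<lambda>z. z $ i)"
proof (rule trig_polynomialI[of "{()}" _ "\<lambda>_. 1" "\<lambda>_. axis i 1"])
  fix z :: "complex ^ 'd"
  have "mpowi z (axis i 1) = (\<Prod>j\<in>UNIV. if j = i then z $ i else 1)"
    unfolding mpowi_def by (intro prod.cong refl) (auto simp: axis_def)
  then show "z $ i = (\<Sum>u\<in>{()}. 1 * mpowi z (axis i 1))"
    by simp
qed simp

lemma trig_polynomial_cnj:
  assumes "trig_polynomial f"
  shows "trig_polynomial (\<lambda>z. cnj (f z))"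
proof -
  obtain P a where "finite P"
    and f: "\<And>z. z \<in> torus \<Longrightarrow> f z = (\<Sum>q\<in>P. a q * mpowi z q)"
    using assms unfolding trig_polynomial_def by metis
  then show ?thesis
    by (intro trig_polynomialI[of P _ "\<lambda>q. cnj (a q)" uminus]) (auto simp: cnj_mpowi)
qed

lemma trig_polynomial_Re_Im:
  assumes "trig_polynomial f"
  shows "trig_polynomial (\<lambda>z. of_real (Re (f z)))" "trig_polynomial (\<lambda>z. of_real (Im (f z)))"
proof -
  have "of_real (Re x) = 1 / 2 * (x + cnj x)" "of_real (Im x) = - (\<i> / 2) * (x + (- 1) * cnj x)" for x
    by (simp_all add: complex_eq_iff)
  then show "trig_polynomial (\<lambda>z. of_real (Re (f z)))" "trig_polynomial (\<lambda>z. of_real (Im (f z)))"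
    by (simp_all only:)
       (intro trig_polynomial_mult trig_polynomial_add trig_polynomial_cnj trig_polynomial_const assms)+
qed

lemma continuous_on_trig_polynomial:
  assumes "trig_polynomial f"
  shows "continuous_on torus f"
proof -
  obtain P a where f: "\<And>z. z \<in> torus \<Longrightarrow> f z = (\<Sum>q\<in>P. a q * mpowi z q)"
    using assms unfolding trig_polynomial_def by metis
  have "continuous_on torus (\<lambda>z. \<Sum>q\<in>P. a q * mpowi z q)"
    by (intro continuous_intros)
  then show ?thesis using f by (simp cong: continuous_on_cong)
qed

text \<open>
  The real-valued trigonometric polynomials form an algebra, and the real and imaginary parts of the
  coordinates separate the points of the torus, so that the Stone-Weierstrass theorem applies.
\<close>

lemma continuous_approximable_by_trig_polynomial:
  fixes h :: "complex ^ 'd \<Rightarrow> real"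
  assumes "continuous_on torus h" "e > 0"
  obtains g :: "complex ^ 'd \<Rightarrow> real"
  where "trig_polynomial (\<lambda>z. of_real (g z))" "\<And>z. z \<in> torus \<Longrightarrow> \<bar>h z - g z\<bar> < e"
proof -
  define R where "R = {g :: complex ^ 'd \<Rightarrow> real. trig_polynomial (\<lambda>z. of_real (g z))}"
  interpret function_ring_on R torus
  proof
    fix f assume "f \<in> R"
    then have "continuous_on torus (\<lambda>z. Re (of_real (f z)))"
      unfolding R_def by (intro continuous_on_Re continuous_on_trig_polynomial) auto
    then show "continuous_on torus f" by simp
  next
    fix x y :: "complex ^ 'd" assume "x \<noteq> y"
    then obtain i where i: "x $ i \<noteq> y $ i" by (auto simp: vec_eq_iff)
    have "(\<lambda>z. Re (z $ i)) \<in> R" "(\<lambda>z. Im (z $ i)) \<in> R"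
      unfolding R_def by (auto intro: trig_polynomial_Re_Im trig_polynomial_component)
    with i show "\<exists>f\<in>R. f x \<noteq> f y" by (metis (no_types, lifting) complex_eq_iff)
  qed (auto simp: R_def compact_torus trig_polynomial_const trig_polynomial_add trig_polynomial_mult)
  from Stone_Weierstrass_basic[OF assms] show thesis
    using that by (auto simp: R_def)
qed

lemma integral_mult_trig_polynomial_eq_0:
  fixes f :: "complex ^ 'd \<Rightarrow> complex"
  assumes f: "integrable haar_torus f" and "\<And>q. (\<integral>z. f z * mpowi z q \<partial>haar_torus) = 0"
    and "trig_polynomial g"
  shows "(\<integral>z. f z * g z \<partial>haar_torus) = 0"
proof -
  obtain P a where g: "\<And>z. z \<in> torus \<Longrightarrow> g z = (\<Sum>q\<in>P. a q * mpowi z q)"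
    using assms unfolding trig_polynomial_def by metis
  have "(\<integral>z. f z * g z \<partial>haar_torus) = (\<integral>z. (\<Sum>q\<in>P. a q * (f z * mpowi z q)) \<partial>haar_torus)"
    by (intro Bochner_Integration.integral_cong refl) (simp add: g sum_distrib_left mult_ac)
  also have "\<dots> = (\<Sum>q\<in>P. \<integral>z. a q * (f z * mpowi z q) \<partial>haar_torus)"
  proof (intro Bochner_Integration.integral_sum integrable_mult_right)
    fix q
    show "integrable haar_torus (\<lambda>z. f z * mpowi z q)"
      using f by (rule Bochner_Integration.integrable_bound)
         (use f in \<open>auto simp: norm_mult borel_measurable_integrable\<close>)
  qed
  also have "\<dots> = 0" using assms(2) by simp
  finally show ?thesis .
qed

lemma integral_mult_continuous_eq_0:
  fixes h :: "complex ^ 'd \<Rightarrow> real"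
  fixes f :: "complex ^ 'd \<Rightarrow> complex"
  assumes f: "integrable haar_torus f" and "\<And>q. (\<integral>z. f z * mpowi z q \<partial>haar_torus) = 0"
    and h: "continuous_on torus h"
  shows "(\<integral>z. f z * of_real (h z) \<partial>haar_torus) = 0"
proof -
  have int: "integrable haar_torus (\<lambda>z. f z * of_real (g z))"
    if g: "continuous_on torus g" for g :: "complex ^ 'd \<Rightarrow> real"
  proof -
    obtain B where B: "\<And>z. z \<in> torus \<Longrightarrow> \<bar>g z\<bar> \<le> B"
      using compact_continuous_image[OF g compact_torus] compact_imp_bounded[of "g ` torus"]
      unfolding bounded_real by auto
    have [measurable]: "g \<in> borel_measurable haar_torus"
      by (rule borel_measurable_haar_torusI[OF g])
    show ?thesis
    proof (rule Bochner_Integration.integrable_bound)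
      show "integrable haar_torus (\<lambda>z. of_real B * f z)" using f by simp
      show "(\<lambda>z. f z * of_real (g z)) \<in> borel_measurable haar_torus"
        using borel_measurable_integrable[OF f] by measurable
      show "AE z in haar_torus. norm (f z * of_real (g z)) \<le> norm (of_real B * f z)"
      proof (rule AE_I2)
        fix z :: "complex ^ 'd" assume "z \<in> space haar_torus"
        then have "\<bar>g z\<bar> \<le> \<bar>B\<bar>" using B[of z] by simp
        then show "norm (f z * of_real (g z)) \<le> norm (of_real B * f z)"
          by (simp add: norm_mult mult.commute mult_right_mono)
      qed
    qed
  qed
  define N where "N = (\<integral>z. norm (f z) \<partial>haar_torus)"
  have *: "norm (\<integral>z. f z * of_real (h z) \<partial>haar_torus) \<le> e * N" if e: "e > 0" for e
  proof -
    obtain g :: "complex ^ 'd \<Rightarrow> real" where g: "trig_polynomial (\<lambda>z. of_real (g z))"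
      and gh: "\<And>z. z \<in> torus \<Longrightarrow> \<bar>h z - g z\<bar> < e"
      using continuous_approximable_by_trig_polynomial[OF h e] by metis
    have "continuous_on torus (\<lambda>z. Re (of_real (g z)))"
      by (intro continuous_on_Re continuous_on_trig_polynomial g)
    then have g': "continuous_on torus g" by simp
    have "(\<integral>z. f z * of_real (h z) \<partial>haar_torus) =
        (\<integral>z. f z * of_real (h z) \<partial>haar_torus) - (\<integral>z. f z * of_real (g z) \<partial>haar_torus)"
      using integral_mult_trig_polynomial_eq_0[OF f assms(2) g] by simp
    also have "\<dots> = (\<integral>z. f z * of_real (h z - g z) \<partial>haar_torus)"
      by (subst Bochner_Integration.integral_diff[symmetric]) (simp_all add: int h g' algebra_simps)
    also have "norm \<dots> \<le> (\<integral>z. e * norm (f z) \<partial>haar_torus)"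
    proof (rule order_trans[OF integral_norm_bound integral_mono])
      show "integrable haar_torus (\<lambda>z. norm (f z * of_real (h z - g z)))"
        by (intro integrable_norm int continuous_intros h g')
      fix z :: "complex ^ 'd" assume "z \<in> space haar_torus"
      then show "norm (f z * of_real (h z - g z)) \<le> e * norm (f z)"
        using mult_right_mono[OF less_imp_le[OF gh], of z "norm (f z)"]
        by (simp add: norm_mult mult.commute flip: of_real_diff)
    qed (use f in auto)
    finally show ?thesis by (simp add: N_def)
  qed
  have "N \<ge> 0" by (simp add: N_def)
  have "norm (\<integral>z. f z * of_real (h z) \<partial>haar_torus) \<le> e" if "e > 0" for e
  proof -
    \<comment> \<open>Adding 1 avoids a case distinction on \<open>N = 0\<close>.\<close>
    have "norm (\<integral>z. f z * of_real (h z) \<partial>haar_torus) \<le> e / (N + 1) * N"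
      using that \<open>N \<ge> 0\<close> *[of "e / (N + 1)"] by simp
    also have "\<dots> \<le> e"
      using that \<open>N \<ge> 0\<close> by (simp add: divide_le_eq algebra_simps)
    finally show ?thesis .
  qed
  then have "norm (\<integral>z. f z * of_real (h z) \<partial>haar_torus) \<le> 0"
    by (rule field_le_epsilon[of _ 0, simplified])
  then show ?thesis by simp
qed

text \<open>
  The indicator function of a closed set is the pointwise limit of the continuous functions
  \<open>max 0 (1 - n d(z, K))\<close>, which are bounded by 1.
\<close>

lemma integral_mult_closed_eq_0:
  fixes K :: "(complex ^ 'd) set"
  fixes f :: "complex ^ 'd \<Rightarrow> complex"
  assumes f: "integrable haar_torus f" and "\<And>q. (\<integral>z. f z * mpowi z q \<partial>haar_torus) = 0"
    and K: "closed K"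
  shows "(\<integral>z. indicator K z *\<^sub>R f z \<partial>haar_torus) = 0"
proof (cases "K = {}")
  case False
  define h where "h n z = max 0 (1 - real n * infdist z K)" for n z
  have h: "continuous_on torus (h n)" for n
    unfolding h_def by (intro continuous_intros)
  have [measurable]: "h n \<in> borel_measurable haar_torus" for n
    by (rule borel_measurable_haar_torusI[OF h])
  have [measurable]: "f \<in> borel_measurable haar_torus" using f by auto
  have "(\<lambda>n. \<integral>z. f z * of_real (h n z) \<partial>haar_torus) \<longlonglongrightarrow> (\<integral>z. indicator K z *\<^sub>R f z \<partial>haar_torus)"
  proof (rule integral_dominated_convergence[where w = "\<lambda>z. norm (f z)"])
    have "K \<in> sets borel" using K by simp
    then have "(\<lambda>z. indicator K z :: real) \<in> borel_measurable haar_torus"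
      by (subst measurable_cong_sets[OF sets_haar_torus refl])
         (intro measurable_restrict_space1 borel_measurable_indicator)
    then show "(\<lambda>z. indicator K z *\<^sub>R f z) \<in> borel_measurable haar_torus"
      by measurable
    show "AE z in haar_torus. (\<lambda>n. f z * of_real (h n z)) \<longlonglongrightarrow> indicator K z *\<^sub>R f z"
    proof (rule AE_I2)
      fix z
      have "(\<lambda>n. h n z) \<longlonglongrightarrow> indicator K z"
      proof (cases "z \<in> K")
        case False
        then have d: "infdist z K > 0"
          using in_closed_iff_infdist_zero[OF K \<open>K \<noteq> {}\<close>, of z] infdist_nonneg[of z K] by linarith
        obtain m :: nat where m: "1 < real m * infdist z K"
          using reals_Archimedean3[OF d] by blast
        have "h n z = 0" if "n \<ge> m" for n
        proof -
          have "real m * infdist z K \<le> real n * infdist z K"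
            using that d by (intro mult_right_mono) auto
          then show ?thesis using m by (simp add: h_def)
        qed
        then have "\<forall>\<^sub>F n in sequentially. h n z = 0" by (auto simp: eventually_sequentially)
        then show ?thesis using False by (simp add: tendsto_eventually)
      qed (simp add: h_def)
      then have "(\<lambda>n. f z * of_real (h n z)) \<longlonglongrightarrow> f z * of_real (indicator K z)"
        by (intro tendsto_intros)
      then show "(\<lambda>n. f z * of_real (h n z)) \<longlonglongrightarrow> indicator K z *\<^sub>R f z"
        by (simp add: scaleR_conv_of_real mult.commute)
    qed
    show "AE z in haar_torus. norm (f z * of_real (h n z)) \<le> norm (f z)" for n
      by (rule AE_I2) (auto simp: norm_mult h_def infdist_nonneg intro!: mult_left_le)
  qed (use f in auto)
  moreover have "(\<integral>z. f z * of_real (h n z) \<partial>haar_torus) = 0" for n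
    by (rule integral_mult_continuous_eq_0[OF f assms(2) h])
  ultimately have "(\<lambda>n. 0) \<longlonglongrightarrow> (\<integral>z. indicator K z *\<^sub>R f z \<partial>haar_torus)"
    by simp
  then show ?thesis
    by (simp add: LIMSEQ_const_iff)
qed simp

text \<open>
  The Borel sets over which \<open>f\<close> integrates to zero form a Dynkin system. It contains the closed sets,
  which are stable under intersection and generate the Borel sets; so it contains every Borel set.
\<close>

theorem AE_eq_0_if_fourier_coeffs_eq_0:
  fixes f :: "complex ^ 'd \<Rightarrow> complex"
  assumes f: "integrable haar_torus f" and "\<And>q. (\<integral>z. f z * mpowi z q \<partial>haar_torus) = 0"
  shows "AE z in haar_torus. f z = 0"
proof (rule haar.density_zero[OF f])
  let ?int = "\<lambda>A. set_lebesgue_integral haar_torus (torus \<inter> A) f"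
  have sets: "torus \<inter> A \<in> sets haar_torus" if "A \<in> sets borel" for A :: "(complex ^ 'd) set"
    using that by (auto simp: sets_haar_torus sets_restrict_space)
  have int: "set_integrable haar_torus (torus \<inter> A) f" if "A \<in> sets borel" for A
    unfolding set_integrable_def by (intro integrable_mult_indicator sets that f)
  have borel: "sigma_sets UNIV {K :: (complex ^ 'd) set. closed K} = sets borel"
    by (simp add: borel_eq_closed)
  have int_eq: "?int A = (\<integral>z. indicator A z *\<^sub>R f z \<partial>haar_torus)" for A
    unfolding set_lebesgue_integral_def
    by (intro Bochner_Integration.integral_cong) (auto simp: indicator_def)
  have closed: "?int K = 0" if "closed K" for K
    unfolding int_eq by (rule integral_mult_closed_eq_0[OF f assms(2) that])
  have zero: "?int A = 0" if "A \<in> sigma_sets UNIV {K. closed K}" for A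
  proof (rule sigma_sets_induct_disjoint[OF _ _ that])
    fix B assume B: "B \<in> sigma_sets UNIV {K. closed K}" "?int B = 0"
    have "?int (B \<union> (UNIV - B)) = ?int B + ?int (UNIV - B)"
      unfolding Int_Un_distrib
      using B(1) by (intro set_integral_Un int) (auto simp: borel)
    then show "?int (UNIV - B) = 0" using B(2) closed[of UNIV] by simp
  next
    fix B :: "nat \<Rightarrow> (complex ^ 'd) set"
    assume B: "disjoint_family B" "range B \<subseteq> sigma_sets UNIV {K. closed K}" "\<And>i. ?int (B i) = 0"
    then have sets_B: "B i \<in> sets borel" for i by (auto simp: borel)
    have "?int (\<Union>i. B i) = (\<Sum>i. ?int (B i))"
      unfolding Int_UN_distrib
    proof (rule lebesgue_integral_countable_add)
      show "set_integrable haar_torus (\<Union>i. torus \<inter> B i) f"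
        using sets_B by (subst Int_UN_distrib[symmetric], intro int sets.countable_UN) auto
      fix i j :: nat assume "i \<noteq> j"
      then show "torus \<inter> B i \<inter> (torus \<inter> B j) = {}"
        using B(1) by (auto simp: disjoint_family_on_def dest!: spec2[of _ i j])
    qed (use sets_B sets in auto)
    then show "?int (\<Union>i. B i) = 0" using B(3) by simp
  qed (use closed[of "{}"] in \<open>auto simp: Int_stable_def closed\<close>)
  fix A assume "A \<in> sets (haar_torus :: (complex ^ 'd) measure)"
  then obtain B where "B \<in> sets borel" "A = torus \<inter> B"
    by (auto simp: sets_haar_torus sets_restrict_space)
  then show "set_lebesgue_integral haar_torus A f = 0"
    using zero[of B] by (simp add: borel)
qed

section \<open>Parseval's identity and the Riesz-Fischer theorem\<close>

definition square_integrable :: "(complex ^ 'd \<Rightarrow> complex) \<Rightarrow> bool" where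
  "square_integrable f \<longleftrightarrow>
     f \<in> borel_measurable haar_torus \<and> integrable haar_torus (\<lambda>z. (norm (f z))\<^sup>2)"

definition fourier_coeff :: "(complex ^ 'd \<Rightarrow> complex) \<Rightarrow> int ^ 'd \<Rightarrow> complex" where
  "fourier_coeff f q = (\<integral>z. f z * mpowi z (- q) \<partial>haar_torus)"

lemma square_integrable_mult:
  assumes "square_integrable f" "square_integrable g"
  shows "integrable haar_torus (\<lambda>z. f z * g z)"
proof (rule Bochner_Integration.integrable_bound)
  show "integrable haar_torus (\<lambda>z. (norm (f z))\<^sup>2 + (norm (g z))\<^sup>2)"
    and "(\<lambda>z. f z * g z) \<in> borel_measurable haar_torus"
    using assms by (auto simp: square_integrable_def)
  show "AE z in haar_torus. norm (f z * g z) \<le> norm ((norm (f z))\<^sup>2 + (norm (g z))\<^sup>2)"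
  proof (rule AE_I2)
    fix z
    have "0 \<le> (norm (f z) - norm (g z))\<^sup>2 + (norm (f z))\<^sup>2 + (norm (g z))\<^sup>2"
      by (intro add_nonneg_nonneg) auto
    then show "norm (f z * g z) \<le> norm ((norm (f z))\<^sup>2 + (norm (g z))\<^sup>2)"
      by (simp add: norm_mult power2_diff)
  qed
qed

lemma square_integrable_bounded:
  assumes "f \<in> borel_measurable haar_torus" "\<And>z. z \<in> torus \<Longrightarrow> norm (f z) \<le> B"
  shows "square_integrable f"
  unfolding square_integrable_def
proof
  show "integrable haar_torus (\<lambda>z. (norm (f z))\<^sup>2)"
    by (rule haar.integrable_const_bound[where B = "B\<^sup>2"])
       (use assms in \<open>auto intro!: AE_I2 power_mono\<close>)
qed fact

lemma square_integrable_trig_polynomial: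
  assumes "trig_polynomial f"
  shows "square_integrable f"
proof -
  have f: "continuous_on torus f" by (rule continuous_on_trig_polynomial[OF assms])
  obtain B where "\<And>z. z \<in> torus \<Longrightarrow> norm (f z) \<le> B"
    using compact_continuous_image[OF f compact_torus] compact_imp_bounded[of "f ` torus"]
    unfolding bounded_iff by auto
  then show ?thesis
    by (rule square_integrable_bounded[OF borel_measurable_haar_torusI[OF f]])
qed

lemma square_integrable_mpowi: "square_integrable (\<lambda>z. mpowi z q)"
  by (rule square_integrable_bounded) auto

lemma square_integrable_imp_integrable:
  assumes "square_integrable f"
  shows "integrable haar_torus f"
  using square_integrable_mult[OF assms square_integrable_mpowi[of 0]] by simp

lemma integrable_mult_mpowi:
  assumes "square_integrable f"
  shows "integrable haar_torus (\<lambda>z. f z * mpowi z q)"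
  by (rule square_integrable_mult[OF assms square_integrable_mpowi])

lemma square_integrable_add:
  assumes "square_integrable f" "square_integrable g"
  shows "square_integrable (\<lambda>z. f z + g z)"
proof -
  have [measurable]: "f \<in> borel_measurable haar_torus" "g \<in> borel_measurable haar_torus"
    using assms unfolding square_integrable_def by blast+
  have "integrable haar_torus (\<lambda>z. (norm (f z + g z))\<^sup>2)"
  proof (rule Bochner_Integration.integrable_bound)
    show "integrable haar_torus (\<lambda>z. 2 * (norm (f z))\<^sup>2 + 2 * (norm (g z))\<^sup>2)"
      using assms by (auto simp: square_integrable_def)
    show "(\<lambda>z. (norm (f z + g z))\<^sup>2) \<in> borel_measurable haar_torus"
      by measurable
    show "AE z in haar_torus. norm ((norm (f z + g z))\<^sup>2) \<le>
        norm (2 * (norm (f z))\<^sup>2 + 2 * (norm (g z))\<^sup>2)"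
    proof (rule AE_I2)
      fix z
      have "(norm (f z + g z))\<^sup>2 \<le> (norm (f z) + norm (g z))\<^sup>2"
        by (intro power_mono norm_triangle_ineq) auto
      also have "\<dots> \<le> 2 * (norm (f z))\<^sup>2 + 2 * (norm (g z))\<^sup>2"
        using zero_le_power2[of "norm (f z) - norm (g z)"] by (simp add: power2_sum power2_diff)
      finally show "norm ((norm (f z + g z))\<^sup>2) \<le> norm (2 * (norm (f z))\<^sup>2 + 2 * (norm (g z))\<^sup>2)"
        by simp
    qed
  qed
  then show ?thesis by (simp add: square_integrable_def)
qed

lemma square_integrable_mult_bounded:
  assumes "square_integrable f" "g \<in> borel_measurable haar_torus"
    and "\<And>z. z \<in> torus \<Longrightarrow> norm (g z) \<le> B"
  shows "square_integrable (\<lambda>z. g z * f z)"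
proof -
  have [measurable]: "f \<in> borel_measurable haar_torus" "g \<in> borel_measurable haar_torus"
    using assms unfolding square_integrable_def by blast+
  have "integrable haar_torus (\<lambda>z. (norm (g z * f z))\<^sup>2)"
  proof (rule Bochner_Integration.integrable_bound)
    show "integrable haar_torus (\<lambda>z. B\<^sup>2 * (norm (f z))\<^sup>2)"
      using assms by (auto simp: square_integrable_def)
    show "(\<lambda>z. (norm (g z * f z))\<^sup>2) \<in> borel_measurable haar_torus"
      by measurable
    show "AE z in haar_torus. norm ((norm (g z * f z))\<^sup>2) \<le> norm (B\<^sup>2 * (norm (f z))\<^sup>2)"
      using assms(3)
      by (auto intro!: AE_I2 mult_right_mono power_mono simp: norm_mult power_mult_distrib)
  qed
  then show ?thesis by (simp add: square_integrable_def)
qed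

lemma square_integrable_trig_mult:
  assumes "trig_polynomial g" "square_integrable f"
  shows "square_integrable (\<lambda>z. g z * f z)"
proof -
  have g: "continuous_on torus g" by (rule continuous_on_trig_polynomial[OF assms(1)])
  obtain B where "\<And>z. z \<in> torus \<Longrightarrow> norm (g z) \<le> B"
    using compact_continuous_image[OF g compact_torus] compact_imp_bounded[of "g ` torus"]
    unfolding bounded_iff by auto
  then show ?thesis
    by (rule square_integrable_mult_bounded[OF assms(2) borel_measurable_haar_torusI[OF g]])
qed

lemma square_integrable_cmult: "square_integrable f \<Longrightarrow> square_integrable (\<lambda>z. c * f z)"
  by (rule square_integrable_trig_mult[OF trig_polynomial_const])

lemma square_integrable_diff:
  "square_integrable f \<Longrightarrow> square_integrable g \<Longrightarrow> square_integrable (\<lambda>z. f z - g z)"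
  using square_integrable_add[of f "\<lambda>z. (- 1) * g z"] square_integrable_cmult[of g "- 1"] by simp

lemma fourier_coeff_add:
  assumes "square_integrable f" "square_integrable g"
  shows "fourier_coeff (\<lambda>z. f z + g z) q = fourier_coeff f q + fourier_coeff g q"
  unfolding fourier_coeff_def distrib_right
  by (intro Bochner_Integration.integral_add integrable_mult_mpowi assms)

lemma fourier_coeff_cmult: "fourier_coeff (\<lambda>z. c * f z) q = c * fourier_coeff f q"
  by (simp add: fourier_coeff_def mult.assoc)

lemma fourier_coeff_diff:
  assumes "square_integrable f" "square_integrable g"
  shows "fourier_coeff (\<lambda>z. f z - g z) q = fourier_coeff f q - fourier_coeff g q"
  using fourier_coeff_add[OF assms(1) square_integrable_cmult[OF assms(2), of "- 1"], of q]
    fourier_coeff_cmult[of "- 1" g q] by simp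

lemma square_integrable_sum:
  "(\<And>i. i \<in> I \<Longrightarrow> square_integrable (f i)) \<Longrightarrow> square_integrable (\<lambda>z. \<Sum>i\<in>I. f i z)"
  by (induction I rule: infinite_finite_induct)
     (auto intro: square_integrable_add square_integrable_trig_polynomial trig_polynomial_const)

lemma fourier_coeff_sum:
  assumes "\<And>i. i \<in> I \<Longrightarrow> square_integrable (f i)"
  shows "fourier_coeff (\<lambda>z. \<Sum>i\<in>I. f i z) q = (\<Sum>i\<in>I. fourier_coeff (f i) q)"
  unfolding fourier_coeff_def sum_distrib_right
  by (intro Bochner_Integration.integral_sum integrable_mult_mpowi assms)

text \<open>
  Multiplication by a character shifts the Fourier coefficients; this is what turns the symbol
  function into a convolution.
\<close>

lemma fourier_coeff_mpowi_mult: "fourier_coeff (\<lambda>z. mpowi z r * f z) q = fourier_coeff f (q - r)"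
  unfolding fourier_coeff_def
  by (intro Bochner_Integration.integral_cong refl) (simp add: mpowi_add[symmetric] mult.assoc mult.left_commute)

lemma fourier_coeff_mpowi: "fourier_coeff (\<lambda>z. mpowi z r) q = (if q = r then 1 else 0)"
  using fourier_coeff_mpowi_mult[of r "\<lambda>_. 1" q] integral_mpowi[of "r - q"]
  by (auto simp: fourier_coeff_def)

lemma square_integrable_trig_sum: "square_integrable (\<lambda>z. \<Sum>q\<in>Q. c q * mpowi z q)"
  by (intro square_integrable_sum square_integrable_cmult square_integrable_mpowi)

lemma fourier_coeff_trig_sum:
  "finite Q \<Longrightarrow> fourier_coeff (\<lambda>z. \<Sum>q\<in>Q. c q * mpowi z q) r = (if r \<in> Q then c r else 0)"
  by (simp add: fourier_coeff_sum square_integrable_cmult square_integrable_mpowi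
        fourier_coeff_cmult fourier_coeff_mpowi if_distrib[of "\<lambda>x. _ * x"] cong: if_cong)

lemma integral_mult_cnj_trig_sum:
  assumes "square_integrable f"
  shows "(\<integral>z. f z * cnj (\<Sum>q\<in>Q. c q * mpowi z q) \<partial>haar_torus) = (\<Sum>q\<in>Q. fourier_coeff f q * cnj (c q))"
proof -
  have "(\<integral>z. f z * cnj (\<Sum>q\<in>Q. c q * mpowi z q) \<partial>haar_torus) =
      (\<integral>z. (\<Sum>q\<in>Q. cnj (c q) * (f z * mpowi z (- q))) \<partial>haar_torus)"
    by (intro Bochner_Integration.integral_cong refl) (simp add: cnj_mpowi sum_distrib_left mult_ac)
  also have "\<dots> = (\<Sum>q\<in>Q. \<integral>z. cnj (c q) * (f z * mpowi z (- q)) \<partial>haar_torus)"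
    by (intro Bochner_Integration.integral_sum integrable_mult_right integrable_mult_mpowi assms)
  also have "\<dots> = (\<Sum>q\<in>Q. fourier_coeff f q * cnj (c q))"
    by (simp add: fourier_coeff_def mult.commute)
  finally show ?thesis .
qed

lemma integral_norm_trig_sum:
  assumes "finite Q"
  shows "(\<integral>z. (norm (\<Sum>q\<in>Q. c q * mpowi z q))\<^sup>2 \<partial>haar_torus) = (\<Sum>q\<in>Q. (norm (c q))\<^sup>2)"
proof -
  let ?S = "\<lambda>z. \<Sum>q\<in>Q. c q * mpowi z q"
  have "of_real (\<integral>z. (norm (?S z))\<^sup>2 \<partial>haar_torus) = (\<integral>z. ?S z * cnj (?S z) \<partial>haar_torus)"
    unfolding integral_complex_of_real[symmetric] complex_norm_square ..
  also have "\<dots> = of_real (\<Sum>q\<in>Q. (norm (c q))\<^sup>2)"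
    unfolding integral_mult_cnj_trig_sum[OF square_integrable_trig_sum]
    using assms by (simp add: fourier_coeff_trig_sum complex_norm_square flip: of_real_power)
  finally show ?thesis by (simp only: of_real_eq_iff)
qed

text \<open>
  The integral of \<open>|f - S|\<^sup>2\<close> is nonnegative, where \<open>S\<close> is the partial Fourier sum of \<open>f\<close> over \<open>Q\<close>.
\<close>

lemma bessel_inequality:
  assumes f: "square_integrable f" and "finite Q"
  shows "(\<Sum>q\<in>Q. (norm (fourier_coeff f q))\<^sup>2) \<le> (\<integral>z. (norm (f z))\<^sup>2 \<partial>haar_torus)"
proof -
  let ?S = "\<lambda>z. \<Sum>q\<in>Q. fourier_coeff f q * mpowi z q"
  let ?s = "\<Sum>q\<in>Q. (norm (fourier_coeff f q))\<^sup>2"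
  have S: "square_integrable ?S" by (rule square_integrable_trig_sum)
  have cS: "integrable haar_torus (\<lambda>z. f z * cnj (?S z))"
    by (rule square_integrable_mult[OF f])
       (intro square_integrable_trig_polynomial trig_polynomial_cnj 
         trig_polynomialI[OF assms(2), of _ "fourier_coeff f" "\<lambda>q. q"] refl)
  have "0 \<le> (\<integral>z. (norm (f z - ?S z))\<^sup>2 \<partial>haar_torus)" by simp
  also have "\<dots> = (\<integral>z. (norm (f z))\<^sup>2 - 2 * Re (f z * cnj (?S z)) + (norm (?S z))\<^sup>2 \<partial>haar_torus)"
    by (intro Bochner_Integration.integral_cong refl)
       (simp only: cmod_power2 minus_complex.sel times_complex.sel cnj.sel, simp add: power2_eq_square algebra_simps)
  also have "\<dots> = (\<integral>z. (norm (f z))\<^sup>2 \<partial>haar_torus) - 2 * Re (\<integral>z. f z * cnj (?S z) \<partial>haar_torus)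
      + (\<integral>z. (norm (?S z))\<^sup>2 \<partial>haar_torus)"
    using f S cS by (simp add: square_integrable_def del: times_complex.sel cnj_sum)
  also have "\<dots> = (\<integral>z. (norm (f z))\<^sup>2 \<partial>haar_torus) - 2 * ?s + ?s"
    unfolding integral_mult_cnj_trig_sum[OF f] integral_norm_trig_sum[OF assms(2)]
    by (simp add: complex_norm_square[symmetric] flip: of_real_power of_real_sum)
  finally show ?thesis by simp
qed


lemma square_summable_tail:
  fixes c :: "'q \<Rightarrow> complex"
  assumes c: "(\<lambda>q. (norm (c q))\<^sup>2) summable_on UNIV" and "e > 0"
  obtains F where "finite F"
    "\<And>G. finite G \<Longrightarrow> G \<inter> F = {} \<Longrightarrow> (\<Sum>q\<in>G. (norm (c q))\<^sup>2) < e"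
proof -
  let ?s = "\<Sum>\<^sub>\<infinity>q. (norm (c q))\<^sup>2"
  have s: "((\<lambda>q. (norm (c q))\<^sup>2) has_sum ?s) UNIV" using c by simp
  then have "((\<lambda>F. \<Sum>q\<in>F. (norm (c q))\<^sup>2) \<longlongrightarrow> ?s) (finite_subsets_at_top UNIV)"
    by (simp add: has_sum_def)
  then have "\<forall>\<^sub>F F in finite_subsets_at_top UNIV. dist (\<Sum>q\<in>F. (norm (c q))\<^sup>2) ?s < e"
    using \<open>e > 0\<close> by (rule tendstoD)
  then obtain F where F: "finite F" "dist (\<Sum>q\<in>F. (norm (c q))\<^sup>2) ?s < e"
    by (auto simp: eventually_finite_subsets_at_top)
  show thesis
  proof
    fix G assume G: "finite G" "G \<inter> F = {}"
    have "(\<Sum>q\<in>F. (norm (c q))\<^sup>2) + (\<Sum>q\<in>G. (norm (c q))\<^sup>2) = (\<Sum>q\<in>F \<union> G. (norm (c q))\<^sup>2)"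
      using F(1) G by (intro sum.union_disjoint[symmetric]) auto
    also have "\<dots> \<le> ?s"
      using F(1) G by (intro finite_sum_le_infsum c) auto
    finally show "(\<Sum>q\<in>G. (norm (c q))\<^sup>2) < e"
      using F(2) by (simp add: dist_real_def)
  qed fact
qed

text \<open>
  The Cauchy-Schwarz inequality for the probability measure on the torus, in the form in which it
  follows from \<open>2 t |g| \<le> t\<^sup>2 + |g|\<^sup>2\<close>.
\<close>

lemma integral_norm_le_if_integral_norm_square_le:
  assumes g: "square_integrable g" and "t > 0"
    and "(\<integral>z. (norm (g z))\<^sup>2 \<partial>haar_torus) \<le> t\<^sup>2"
  shows "(\<integral>z. norm (g z) \<partial>haar_torus) \<le> t"
proof -
  have "(\<integral>z. norm (g z) \<partial>haar_torus) \<le> (\<integral>z. t / 2 + (norm (g z))\<^sup>2 / (2 * t) \<partial>haar_torus)"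
  proof (rule integral_mono)
    fix z
    have "0 \<le> (norm (g z) - t)\<^sup>2" by simp
    then show "norm (g z) \<le> t / 2 + (norm (g z))\<^sup>2 / (2 * t)"
      using \<open>t > 0\<close> by (simp add: power2_diff field_simps power2_eq_square)
  qed (use g square_integrable_imp_integrable in \<open>auto simp: square_integrable_def\<close>)
  also have "\<dots> = t / 2 + (\<integral>z. (norm (g z))\<^sup>2 \<partial>haar_torus) / (2 * t)"
    using g by (simp add: square_integrable_def)
  also have "\<dots> \<le> t / 2 + t\<^sup>2 / (2 * t)"
    using assms by (intro add_left_mono divide_right_mono) auto
  also have "\<dots> = t" using \<open>t > 0\<close> by (simp add: power2_eq_square)
  finally show ?thesis .
qed

text \<open>
  Finite blocks \<open>A n\<close> of indices exhaust the support of \<open>c\<close>, with tails so small that the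
  trigonometric polynomials \<open>g n\<close> of these blocks have summable \<open>L\<^sup>1\<close> norms. Their sum then converges absolutely almost
  everywhere and may be integrated term by term, which gives its Fourier coefficients; Fatou's lemma
  bounds its \<open>L\<^sup>2\<close> norm.
\<close>

theorem riesz_fischer:
  fixes c :: "int ^ 'd \<Rightarrow> complex"
  assumes c: "(\<lambda>q. (norm (c q))\<^sup>2) summable_on UNIV"
  obtains f where "square_integrable f" "fourier_coeff f = c"
    "(\<integral>z. (norm (f z))\<^sup>2 \<partial>haar_torus) \<le> (\<Sum>\<^sub>\<infinity>q. (norm (c q))\<^sup>2)"
proof -
  \<comment> \<open>The bound is written as a square because it is compared with an \<open>L\<^sup>2\<close> norm squared.\<close>
  have "\<forall>n. \<exists>F. finite F \<and>
      (\<forall>G. finite G \<longrightarrow> G \<inter> F = {} \<longrightarrow> (\<Sum>q\<in>G. (norm (c q))\<^sup>2) < ((1 / 2) ^ n)\<^sup>2)"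
  proof
    fix n :: nat
    have "((1 / 2 :: real) ^ n)\<^sup>2 > 0" by simp
    from square_summable_tail[OF c this] show "\<exists>F. finite F \<and>
      (\<forall>G. finite G \<longrightarrow> G \<inter> F = {} \<longrightarrow> (\<Sum>q\<in>G. (norm (c q))\<^sup>2) < ((1 / 2) ^ n)\<^sup>2)"
      by metis
  qed
  then obtain F where F: "\<And>n. finite (F n)"
    and tail: "\<And>n G. finite G \<Longrightarrow> G \<inter> F n = {} \<Longrightarrow> (\<Sum>q\<in>G. (norm (c q))\<^sup>2) < ((1 / 2) ^ n)\<^sup>2"
    by metis
  define A where "A = disjointed F"
  define g where "g n z = (\<Sum>q\<in>A n. c q * mpowi z q)" for n z
  have A: "finite (A n)" for n
    unfolding A_def by (rule finite_subset[OF disjointed_subset F])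
  have disj: "disjoint_family A"
    unfolding A_def by (rule disjoint_family_disjointed)
  have g: "square_integrable (g n)" for n
    unfolding g_def by (rule square_integrable_trig_sum)
  have coeff_g: "fourier_coeff (g n) q = (if q \<in> A n then c q else 0)" for n q
    unfolding g_def by (rule fourier_coeff_trig_sum[OF A])
  have "(\<integral>z. norm (g (Suc n) z) \<partial>haar_torus) \<le> (1 / 2) ^ n" for n
  proof (rule integral_norm_le_if_integral_norm_square_le[OF g])
    \<comment> \<open>Only the blocks from index 1 on avoid an earlier \<open>F n\<close>, hence the shift in the estimate.\<close>
    have "A (Suc n) \<inter> F n = {}" by (auto simp: A_def disjointed_def)
    from tail[OF A this] show "(\<integral>z. (norm (g (Suc n) z))\<^sup>2 \<partial>haar_torus) \<le> ((1 / 2) ^ n)\<^sup>2"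
      unfolding g_def integral_norm_trig_sum[OF A] by simp
  qed simp
  then have "summable (\<lambda>n. \<integral>z. norm (g (Suc n) z) \<partial>haar_torus)"
    by (intro summable_comparison_test[OF _ summable_geometric[of "1 / 2 :: real"]]) auto
  then have sum_int: "summable (\<lambda>n. \<integral>z. norm (g n z) \<partial>haar_torus)"
    using summable_Suc_iff[of "\<lambda>n. \<integral>z. norm (g n z) \<partial>haar_torus"] by blast
  have int: "integrable haar_torus (g n)" for n
    by (rule square_integrable_imp_integrable[OF g])
  then have [measurable]: "g n \<in> borel_measurable haar_torus" for n by auto
  have AE_summable: "AE z in haar_torus. summable (\<lambda>n. norm (g n z))"
  proof -
    have "(\<integral>\<^sup>+z. (\<Sum>n. ennreal (norm (g n z))) \<partial>haar_torus) =
        (\<Sum>n. \<integral>\<^sup>+z. ennreal (norm (g n z)) \<partial>haar_torus)"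
      by (rule nn_integral_suminf) simp
    also have "\<dots> = (\<Sum>n. ennreal (\<integral>z. norm (g n z) \<partial>haar_torus))"
      by (intro suminf_cong nn_integral_eq_integral integrable_norm int) simp
    also have "\<dots> \<noteq> \<infinity>"
      unfolding infinity_ennreal_def by (rule ennreal_suminf_neq_top[OF sum_int]) simp
    finally have "AE z in haar_torus. (\<Sum>n. ennreal (norm (g n z))) \<noteq> \<infinity>"
      by (intro nn_integral_PInf_AE) simp_all
    then show ?thesis
    proof (rule eventually_mono)
      fix z assume "(\<Sum>n. ennreal (norm (g n z))) \<noteq> \<infinity>"
      then show "summable (\<lambda>n. norm (g n z))"
        by (intro summable_suminf_not_top) simp_all
    qed
  qed
  define f where "f z = (\<Sum>n. g n z)" for z
  have [measurable]: "f \<in> borel_measurable haar_torus"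
    unfolding f_def[abs_def] by measurable
  have S: "(\<Sum>n<N. g n z) = (\<Sum>q\<in>(\<Union>n<N. A n). c q * mpowi z q)" for N z
    unfolding g_def
  proof (rule sum.UNION_disjoint[symmetric])
    show "\<forall>i\<in>{..<N}. \<forall>j\<in>{..<N}. i \<noteq> j \<longrightarrow> A i \<inter> A j = {}"
      using disj unfolding disjoint_family_on_def by blast
  qed (use A in auto)
  have fatou: "(\<integral>\<^sup>+z. ennreal ((norm (f z))\<^sup>2) \<partial>haar_torus) \<le> ennreal (\<Sum>\<^sub>\<infinity>q. (norm (c q))\<^sup>2)"
  proof -
    have "(\<integral>\<^sup>+z. ennreal ((norm (f z))\<^sup>2) \<partial>haar_torus) =
        (\<integral>\<^sup>+z. liminf (\<lambda>N. ennreal ((norm (\<Sum>n<N. g n z))\<^sup>2)) \<partial>haar_torus)"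
    proof (rule nn_integral_cong_AE)
      show "AE z in haar_torus. ennreal ((norm (f z))\<^sup>2) = liminf (\<lambda>N. ennreal ((norm (\<Sum>n<N. g n z))\<^sup>2))"
        using AE_summable
      proof eventually_elim
        case (elim z)
        then have "(\<lambda>N. \<Sum>n<N. g n z) \<longlonglongrightarrow> f z"
          unfolding f_def by (rule summable_LIMSEQ[OF summable_norm_cancel])
        then have "(\<lambda>N. ennreal ((norm (\<Sum>n<N. g n z))\<^sup>2)) \<longlonglongrightarrow> ennreal ((norm (f z))\<^sup>2)"
          by (intro tendsto_intros)
        from lim_imp_Liminf[OF trivial_limit_sequentially this] show ?case by (rule sym)
      qed
    qed
    also have "\<dots> \<le> liminf (\<lambda>N. \<integral>\<^sup>+z. ennreal ((norm (\<Sum>n<N. g n z))\<^sup>2) \<partial>haar_torus)"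
      by (rule nn_integral_liminf) measurable
    also have "\<dots> \<le> limsup (\<lambda>N. \<integral>\<^sup>+z. ennreal ((norm (\<Sum>n<N. g n z))\<^sup>2) \<partial>haar_torus)"
      by (rule Liminf_le_Limsup) simp
    also have "\<dots> \<le> ennreal (\<Sum>\<^sub>\<infinity>q. (norm (c q))\<^sup>2)"
    proof (intro Limsup_bounded always_eventually allI)
      fix N
      have "(\<integral>\<^sup>+z. ennreal ((norm (\<Sum>n<N. g n z))\<^sup>2) \<partial>haar_torus) =
          ennreal (\<integral>z. (norm (\<Sum>n<N. g n z))\<^sup>2 \<partial>haar_torus)"
        using square_integrable_sum[of "{..<N}" g, OF g]
        by (intro nn_integral_eq_integral) (auto simp: square_integrable_def)
      also have "\<dots> = ennreal (\<Sum>q\<in>(\<Union>n<N. A n). (norm (c q))\<^sup>2)"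
        unfolding S using A by (subst integral_norm_trig_sum) auto
      also have "\<dots> \<le> ennreal (\<Sum>\<^sub>\<infinity>q. (norm (c q))\<^sup>2)"
        using A by (intro ennreal_leI finite_sum_le_infsum c) auto
      finally show "(\<integral>\<^sup>+z. ennreal ((norm (\<Sum>n<N. g n z))\<^sup>2) \<partial>haar_torus) \<le> ennreal (\<Sum>\<^sub>\<infinity>q. (norm (c q))\<^sup>2)" .
    qed
    finally show ?thesis .
  qed
  then have "(\<integral>\<^sup>+z. ennreal (norm ((norm (f z))\<^sup>2)) \<partial>haar_torus) < \<infinity>"
    using le_less_trans[OF fatou ennreal_less_top] by simp
  then have "integrable haar_torus (\<lambda>z. (norm (f z))\<^sup>2)"
    by (intro integrableI_bounded) measurable
  then have f: "square_integrable f" by (simp add: square_integrable_def)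
  have "(\<integral>z. (norm (f z))\<^sup>2 \<partial>haar_torus) \<le> (\<Sum>\<^sub>\<infinity>q. (norm (c q))\<^sup>2)"
    using fatou f by (simp add: nn_integral_eq_integral square_integrable_def infsum_nonneg)
  moreover have "fourier_coeff f q = c q" for q
  proof -
    have "fourier_coeff f q = (\<integral>z. (\<Sum>n. g n z * mpowi z (- q)) \<partial>haar_torus)"
      unfolding fourier_coeff_def
    proof (rule integral_cong_AE)
      show "AE z in haar_torus. f z * mpowi z (- q) = (\<Sum>n. g n z * mpowi z (- q))"
        using AE_summable by eventually_elim (simp add: f_def suminf_mult2 summable_norm_cancel)
    qed measurable
    also have "\<dots> = (\<Sum>n. fourier_coeff (g n) q)"
      unfolding fourier_coeff_def
    proof (rule integral_suminf)
      show "integrable haar_torus (\<lambda>z. g n z * mpowi z (- q))" for n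
        by (rule integrable_mult_mpowi[OF g])
      show "AE z in haar_torus. summable (\<lambda>n. norm (g n z * mpowi z (- q)))"
        using AE_summable AE_space by eventually_elim (simp add: norm_mult)
      have "(\<integral>z. norm (g n z * mpowi z (- q)) \<partial>haar_torus) = (\<integral>z. norm (g n z) \<partial>haar_torus)" for n
        by (intro Bochner_Integration.integral_cong refl) (simp add: norm_mult)
      then show "summable (\<lambda>n. \<integral>z. norm (g n z * mpowi z (- q)) \<partial>haar_torus)"
        using sum_int by simp
    qed
    also have "\<dots> = c q"
    proof (cases "\<exists>m. q \<in> A m")
      case True
      then obtain m where m: "q \<in> A m" by blast
      then have "fourier_coeff (g n) q = (if n = m then c q else 0)" for n
        using disj by (auto simp: coeff_g disjoint_family_on_def)
      then show ?thesis using sums_single[of m "\<lambda>_. c q"] by (simp add: sums_iff)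
    next
      case False
      \<comment> \<open>An index outside all blocks lies in every tail, so its coefficient is zero.\<close>
      then have "q \<notin> F n" for n
        using UN_disjointed_eq[of F] unfolding A_def by blast
      then have small: "(norm (c q))\<^sup>2 < ((1 / 2) ^ n)\<^sup>2" for n
        using tail[of "{q}" n] by simp
      have "(norm (c q)) \<le> 0"
      proof (rule LIMSEQ_le_const)
        show "(\<lambda>n. (1 / 2 :: real) ^ n) \<longlonglongrightarrow> 0" by (rule LIMSEQ_realpow_zero) auto
        show "\<exists>N. \<forall>n\<ge>N. norm (c q) \<le> (1 / 2) ^ n"
          using less_imp_le[OF power2_less_imp_less[OF small]] by simp
      qed
      then show ?thesis using False by (simp add: coeff_g)
    qed
    finally show ?thesis .
  qed
  ultimately show thesis using that[OF f] by blast
qed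

theorem parseval:
  assumes f: "square_integrable f"
  shows "((\<lambda>q. (norm (fourier_coeff f q))\<^sup>2) has_sum (\<integral>z. (norm (f z))\<^sup>2 \<partial>haar_torus)) UNIV"
proof -
  let ?c = "fourier_coeff f"
  have c: "(\<lambda>q. (norm (?c q))\<^sup>2) summable_on UNIV"
    using bessel_inequality[OF f] by (intro nonneg_bdd_above_summable_on) (auto intro!: bdd_aboveI2)
  then obtain g where g: "square_integrable g" "fourier_coeff g = ?c"
    and le: "(\<integral>z. (norm (g z))\<^sup>2 \<partial>haar_torus) \<le> (\<Sum>\<^sub>\<infinity>q. (norm (?c q))\<^sup>2)"
    by (rule riesz_fischer)
  have fg: "square_integrable (\<lambda>z. f z - g z)" by (rule square_integrable_diff[OF f g(1)])
  have "AE z in haar_torus. f z - g z = 0"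
  proof (rule AE_eq_0_if_fourier_coeffs_eq_0)
    show "integrable haar_torus (\<lambda>z. f z - g z)"
      by (rule square_integrable_imp_integrable[OF fg])
    show "(\<integral>z. (f z - g z) * mpowi z q \<partial>haar_torus) = 0" for q
      using fourier_coeff_diff[OF f g(1), of "- q"] g(2) by (simp add: fourier_coeff_def)
  qed
  then have "(\<integral>z. (norm (f z))\<^sup>2 \<partial>haar_torus) = (\<integral>z. (norm (g z))\<^sup>2 \<partial>haar_torus)"
    using f g(1) by (intro integral_cong_AE) (auto simp: square_integrable_def)
  with le have "(\<integral>z. (norm (f z))\<^sup>2 \<partial>haar_torus) \<le> (\<Sum>\<^sub>\<infinity>q. (norm (?c q))\<^sup>2)" by simp
  moreover have "(\<Sum>\<^sub>\<infinity>q. (norm (?c q))\<^sup>2) \<le> (\<integral>z. (norm (f z))\<^sup>2 \<partial>haar_torus)"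
    using bessel_inequality[OF f] c by (intro infsum_le_finite_sums) auto
  ultimately show ?thesis using has_sum_infsum[OF c] by simp
qed

section \<open>The Fourier transform of vector-valued functions\<close>

lemma norm_vec_power2: "(norm (x :: complex ^ 'k))\<^sup>2 = (\<Sum>k\<in>UNIV. (norm (x $ k))\<^sup>2)"
  by (simp add: norm_vec_def L2_set_def sum_nonneg)

lemma L2_torus_iff:
  fixes f :: "complex ^ 'd \<Rightarrow> complex ^ 'k"
  shows "f \<in> L2_torus \<longleftrightarrow> (\<forall>k. square_integrable (\<lambda>z. f z $ k))"
proof
  assume f: "f \<in> L2_torus"
  show "\<forall>k. square_integrable (\<lambda>z. f z $ k)"
  proof
    fix k
    have "(\<lambda>x :: complex ^ 'k. x $ k) \<in> borel_measurable borel"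
      by (intro borel_measurable_continuous_onI continuous_intros)
    then have [measurable]: "(\<lambda>z. f z $ k) \<in> borel_measurable haar_torus"
      using f measurable_compose[of f] unfolding L2_torus_def by blast
    have "integrable haar_torus (\<lambda>z. (norm (f z $ k))\<^sup>2)"
    proof (rule Bochner_Integration.integrable_bound)
      show "integrable haar_torus (\<lambda>z. (norm (f z))\<^sup>2)" using f by (simp add: L2_torus_def)
      show "AE z in haar_torus. norm ((norm (f z $ k))\<^sup>2) \<le> norm ((norm (f z))\<^sup>2)"
        by (auto intro!: AE_I2 power_mono simp: Finite_Cartesian_Product.norm_nth_le)
    qed measurable
    then show "square_integrable (\<lambda>z. f z $ k)" by (simp add: square_integrable_def)
  qed
next
  assume f: "\<forall>k. square_integrable (\<lambda>z. f z $ k)"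
  have "(\<lambda>z. \<Sum>k\<in>UNIV. axis k (f z $ k)) \<in> borel_measurable haar_torus"
  proof (intro borel_measurable_sum)
    fix k
    have "continuous_on UNIV (axis k :: complex \<Rightarrow> complex ^ 'k)"
      unfolding axis_def
    proof (intro continuous_on_vec_lambda)
      show "continuous_on UNIV (\<lambda>x :: complex. if i = k then x else 0)" for i
        by (cases "i = k") (simp_all add: continuous_on_id)
    qed
    then have "(axis k :: complex \<Rightarrow> complex ^ 'k) \<in> borel_measurable borel"
      by (rule borel_measurable_continuous_onI)
    then show "(\<lambda>z. axis k (f z $ k)) \<in> borel_measurable haar_torus"
      using f measurable_compose[of "\<lambda>z. f z $ k"] unfolding square_integrable_def by blast
  qed
  moreover have "(\<Sum>k\<in>UNIV. axis k (x $ k)) = x" for x :: "complex ^ 'k"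
    by (simp add: vec_eq_iff axis_def if_distrib cong: if_cong)
  ultimately show "f \<in> L2_torus"
    using f unfolding L2_torus_def norm_vec_power2 square_integrable_def
    by auto
qed

lemma fourier_map_label:
  assumes "inj (\<lambda>(k, q). lab k q)"
  shows "fourier_map lab f (lab k q) = fourier_coeff (\<lambda>z. f z $ k) q"
proof -
  have "{(k', q'). lab k' q' = lab k q} = {(k, q)}"
    using assms by (auto simp: inj_def)
  then show ?thesis by (simp add: fourier_map_def fourier_coeff_def)
qed

lemma fourier_map_outside:
  assumes "s \<notin> range (\<lambda>(k, q). lab k q)"
  shows "fourier_map lab f s = 0"
proof -
  have "{(k, q). lab k q = s} = {}"
    using assms by (auto simp: image_iff)
  then show ?thesis unfolding fourier_map_def by (simp only: sum.empty)
qed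

text \<open>
  As \<open>fourier_map lab f\<close> vanishes outside the range of the labels, an identity for it need only be
  checked on labels, where its values are Fourier coefficients.
\<close>

lemma fourier_map_eqI:
  assumes "bij_betw (\<lambda>(k, q). lab k q) UNIV S"
    and "\<And>s. s \<notin> S \<Longrightarrow> u s = 0"
    and "\<And>k q. fourier_coeff (\<lambda>z. f z $ k) q = u (lab k q)"
  shows "fourier_map lab f = u"
proof
  fix s
  have lab: "inj (\<lambda>(k, q). lab k q)" "range (\<lambda>(k, q). lab k q) = S"
    using assms(1) by (auto simp: bij_betw_def)
  show "fourier_map lab f s = u s"
  proof (cases "s \<in> S")
    case True
    then obtain k q where "s = lab k q" using lab(2) by auto
    then show ?thesis using assms(3) fourier_map_label[OF lab(1)] by metis
  next
    case False
    then show ?thesis using assms(2) lab(2) fourier_map_outside[of s lab] by metis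
  qed
qed

lemma has_sum_fourier_map:
  fixes f :: "complex ^ 'd \<Rightarrow> complex ^ 'k"
  assumes lab: "bij_betw (\<lambda>(k, q). lab k q) UNIV S" and f: "f \<in> L2_torus"
  shows "((\<lambda>s. (norm (fourier_map lab f s))\<^sup>2) has_sum (\<integral>z. (norm (f z))\<^sup>2 \<partial>haar_torus)) S"
proof -
  have inj: "inj (\<lambda>(k, q). lab k q)" using lab by (simp add: bij_betw_def)
  have f': "square_integrable (\<lambda>z. f z $ k)" for k using f by (simp add: L2_torus_iff)
  have 1: "((\<lambda>q. (norm (fourier_map lab f (lab k q)))\<^sup>2) has_sum
      (\<integral>z. (norm (f z $ k))\<^sup>2 \<partial>haar_torus)) UNIV" for k
    unfolding fourier_map_label[OF inj] by (rule parseval[OF f'])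
  have 2: "((\<lambda>k. \<integral>z. (norm (f z $ k))\<^sup>2 \<partial>haar_torus) has_sum
      (\<Sum>k\<in>UNIV. \<integral>z. (norm (f z $ k))\<^sup>2 \<partial>haar_torus)) UNIV"
    by (simp add: has_sum_finite)
  have "((\<lambda>(k, q). (norm (fourier_map lab f (lab k q)))\<^sup>2) has_sum
      (\<Sum>k\<in>UNIV. \<integral>z. (norm (f z $ k))\<^sup>2 \<partial>haar_torus)) (SIGMA k:UNIV. UNIV)"
  proof (rule has_sum_SigmaI[OF _ 2])
    show "(\<lambda>(k, q). (norm (fourier_map lab f (lab k q)))\<^sup>2) summable_on (SIGMA k:UNIV. UNIV)"
      by (rule summable_on_SigmaI[OF _ has_sum_imp_summable[OF 2]]) (simp_all add: 1)
  qed (simp add: 1)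
  also have "(\<Sum>k\<in>UNIV. \<integral>z. (norm (f z $ k))\<^sup>2 \<partial>haar_torus) = (\<integral>z. (norm (f z))\<^sup>2 \<partial>haar_torus)"
    unfolding norm_vec_power2 using f'
    by (subst Bochner_Integration.integral_sum) (auto simp: square_integrable_def)
  finally show ?thesis
    using has_sum_reindex_bij_betw[OF lab, of "\<lambda>s. (norm (fourier_map lab f s))\<^sup>2"]
    by (simp add: case_prod_unfold)
qed

lemma fourier_map_eq_0_imp_AE_eq_0:
  assumes lab: "bij_betw (\<lambda>(k, q). lab k q) UNIV S" and f: "f \<in> L2_torus"
    and "fourier_map lab f = (\<lambda>_. 0)"
  shows "AE z in haar_torus. f z = 0"
proof -
  have "(\<integral>z. (norm (f z))\<^sup>2 \<partial>haar_torus) = 0"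
    using infsumI[OF has_sum_fourier_map[OF lab f]] assms(3) by simp
  then show ?thesis
    using f by (subst (asm) integral_nonneg_eq_0_iff_AE) (auto simp: L2_torus_def)
qed

lemma fourier_map_eq_0_if_AE_eq_0:
  fixes f :: "complex ^ 'd \<Rightarrow> complex ^ 'k"
  assumes lab: "bij_betw (\<lambda>(k, q). lab k q) UNIV S" and "AE z in haar_torus. f z = 0"
  shows "fourier_map lab f = (\<lambda>_. 0)"
proof (rule fourier_map_eqI[OF lab])
  show "fourier_coeff (\<lambda>z. f z $ k) q = 0" for k q
    unfolding fourier_coeff_def
    by (rule integral_eq_zero_AE) (use assms(2) in \<open>auto elim!: eventually_mono\<close>)
qed simp

text \<open>
  Coordinatewise this is Parseval's identity for the isometry and the Riesz-Fischer theorem for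
  surjectivity.
\<close>

theorem unitary_fourier_map:
  fixes lab :: "'k::finite \<Rightarrow> int ^ 'd \<Rightarrow> 's"
  assumes lab: "bij_betw (\<lambda>(k, q). lab k q) UNIV S"
  shows "unitary_L2_ell2 (fourier_map lab) S"
  unfolding unitary_L2_ell2_def
proof (intro conjI ballI allI)
  have inj: "inj (\<lambda>(k, q). lab k q)" and ran: "range (\<lambda>(k, q). lab k q) = S"
    using lab by (auto simp: bij_betw_def)
  fix f :: "complex ^ 'd \<Rightarrow> complex ^ 'k" assume f: "f \<in> L2_torus"
  show "fourier_map lab f \<in> ell2 S"
    using has_sum_imp_summable[OF has_sum_fourier_map[OF lab f]] fourier_map_outside[of _ lab] ran
    by (simp add: ell2_def)
  show "(\<Sum>\<^sub>\<infinity>s\<in>S. (norm (fourier_map lab f s))\<^sup>2) = (\<integral>z. (norm (f z))\<^sup>2 \<partial>haar_torus)"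
    by (rule infsumI[OF has_sum_fourier_map[OF lab f]])
  fix g :: "complex ^ 'd \<Rightarrow> complex ^ 'k" and c assume g: "g \<in> L2_torus"
  show "fourier_map lab (\<lambda>z. c *s f z + g z) = (\<lambda>s. c * fourier_map lab f s + fourier_map lab g s)"
  proof (rule fourier_map_eqI[OF lab])
    fix k q
    show "fourier_coeff (\<lambda>z. (c *s f z + g z) $ k) q =
        c * fourier_map lab f (lab k q) + fourier_map lab g (lab k q)"
      using f g unfolding fourier_map_label[OF inj] L2_torus_iff
      by (simp add: fourier_coeff_add square_integrable_cmult fourier_coeff_cmult)
  qed (use fourier_map_outside[of _ lab] ran in simp)
next
  fix u :: "'s \<Rightarrow> complex" assume u: "u \<in> ell2 S"
  have "\<forall>k. \<exists>f. square_integrable f \<and> fourier_coeff f = (\<lambda>q. u (lab k q))"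
  proof
    fix k
    have "(\<lambda>(k, q). (norm (u (lab k q)))\<^sup>2) summable_on UNIV"
      using u summable_on_reindex_bij_betw[OF lab, of "\<lambda>s. (norm (u s))\<^sup>2"]
      by (simp add: ell2_def case_prod_unfold)
    then have "(\<lambda>(k, q). (norm (u (lab k q)))\<^sup>2) summable_on (Pair k ` UNIV)"
      by (rule summable_on_subset_banach) simp
    then have "(\<lambda>q. (norm (u (lab k q)))\<^sup>2) summable_on UNIV"
      by (subst (asm) summable_on_reindex) (auto simp: o_def inj_on_def)
    from riesz_fischer[OF this]
    show "\<exists>f. square_integrable f \<and> fourier_coeff f = (\<lambda>q. u (lab k q))" by metis
  qed
  then obtain h where h: "\<And>k. square_integrable (h k)" "\<And>k. fourier_coeff (h k) = (\<lambda>q. u (lab k q))"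
    by metis
  let ?f = "\<lambda>z. \<chi> k. h k z"
  have "?f \<in> L2_torus" using h(1) by (simp add: L2_torus_iff)
  moreover have "fourier_map lab ?f = u"
    by (rule fourier_map_eqI[OF lab]) (use u h(2) in \<open>auto simp: ell2_def\<close>)
  ultimately show "\<exists>f\<in>L2_torus. fourier_map lab f = u" by blast
qed

lemma maps_basis_fourier_map:
  fixes lab :: "'k::finite \<Rightarrow> int ^ 'd \<Rightarrow> 's"
  assumes lab: "bij_betw (\<lambda>(k, q). lab k q) UNIV S"
  shows "maps_basis lab (fourier_map lab)"
  unfolding maps_basis_def
proof (intro allI, rule fourier_map_eqI[OF lab])
  have inj: "inj (\<lambda>(k, q). lab k q)" and ran: "range (\<lambda>(k, q). lab k q) = S"
    using lab by (auto simp: bij_betw_def)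
  fix k q
  show "(if s = lab k q then 1 else 0) = 0" if "s \<notin> S" for s
    using that ran by auto
  fix j r
  have "(lab j r = lab k q) = (j = k \<and> r = q)" using inj by (auto simp: inj_def)
  then show "fourier_coeff (\<lambda>z. axis k (mpowi z q) $ j) r = (if lab j r = lab k q then 1 else 0)"
    by (cases "j = k") (auto simp: axis_def fourier_coeff_mpowi, simp add: fourier_coeff_def)
qed

text \<open>
  Multiplication by a matrix of trigonometric polynomials acts on Fourier coefficients as a
  convolution. The hypothesis is in the form shared by the symbol function, where \<open>g r = - r\<close>, and its
  conjugate transpose, where \<open>g r = r\<close>.
\<close>

lemma fourier_coeff_trig_matrix_mult:
  assumes "\<And>z j. z \<in> torus \<Longrightarrow> \<Psi> z $ k $ j = (\<Sum>r\<in>N j. b j r * mpowi z (g r))"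
    and f: "f \<in> L2_torus"
  shows "fourier_coeff (\<lambda>z. mult_op \<Psi> f z $ k) q =
    (\<Sum>j\<in>UNIV. \<Sum>r\<in>N j. b j r * fourier_coeff (\<lambda>z. f z $ j) (q - g r))"
proof -
  have f': "square_integrable (\<lambda>z. f z $ k)" for k using f by (simp add: L2_torus_iff)
  have sq: "square_integrable (\<lambda>z. b j r * (mpowi z (g r) * f z $ j))" for j r
    by (rule square_integrable_cmult, rule square_integrable_mult_bounded[OF f', where B = 1]) simp_all
  have "fourier_coeff (\<lambda>z. mult_op \<Psi> f z $ k) q =
      fourier_coeff (\<lambda>z. \<Sum>j\<in>UNIV. \<Sum>r\<in>N j. b j r * (mpowi z (g r) * f z $ j)) q"
    unfolding fourier_coeff_def
    by (intro Bochner_Integration.integral_cong refl)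
       (simp add: mult_op_def matrix_vector_mult_def assms(1) sum_distrib_right mult.assoc)
  also have "\<dots> = (\<Sum>j\<in>UNIV. \<Sum>r\<in>N j. fourier_coeff (\<lambda>z. b j r * (mpowi z (g r) * f z $ j)) q)"
    by (subst fourier_coeff_sum, intro square_integrable_sum sq)
       (intro sum.cong refl fourier_coeff_sum sq)
  finally show ?thesis by (simp only: fourier_coeff_cmult fourier_coeff_mpowi_mult)
qed

lemma mult_op_L2_torus:
  fixes \<Psi> :: "complex ^ 'd \<Rightarrow> complex ^ 'k ^ 'm"
  assumes "\<And>k j. trig_polynomial (\<lambda>z. \<Psi> z $ k $ j)" and "f \<in> L2_torus"
  shows "mult_op \<Psi> f \<in> L2_torus"
  unfolding L2_torus_iff mult_op_def matrix_vector_mult_def vec_lambda_beta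
proof (intro allI square_integrable_sum)
  fix k j
  have "square_integrable (\<lambda>z. f z $ j)" using assms(2) by (simp add: L2_torus_iff)
  then show "square_integrable (\<lambda>z. \<Psi> z $ k $ j * f z $ j)"
    by (rule square_integrable_trig_mult[OF assms(1)])
qed

section \<open>Labellings of a crystal framework by its translation group\<close>

context crystal_framework
begin

lemma tr_inj_on: "inj_on (tr q) V"
proof (rule inj_onI)
  fix v w assume "v \<in> V" "w \<in> V" "tr q v = tr q w"
  then have "tr (- q + q) v = tr (- q + q) w" by (simp only: tr_add)
  then show "v = w" using \<open>v \<in> V\<close> \<open>w \<in> V\<close> by (simp add: tr_zero)
qed

lemma motif_edge_subset: "e \<in> F\<^sub>e \<Longrightarrow> e \<subseteq> V"
  using motif_edges(2) simple_graph by blast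

lemma motif_vertex_in_V: "v \<in> F\<^sub>v \<Longrightarrow> v \<in> V"
  using motif_vertices(2) motif_edge_subset by blast

lemma motif_translate_unique:
  assumes "v \<in> F\<^sub>v" "w \<in> F\<^sub>v" "tr q v = tr r w"
  shows "v = w \<and> q = r"
proof -
  have "q = r"
    using vertex_translates(1) assms unfolding disjoint_family_on_def by blast
  with assms show ?thesis
    using inj_onD[OF tr_inj_on, of q v w] motif_vertex_in_V by blast
qed

lemma motif_edge_translate_unique:
  assumes "e \<in> F\<^sub>e" "f \<in> F\<^sub>e" "tr q ` e = tr r ` f"
  shows "e = f \<and> q = r"
proof -
  have "q = r"
    using edge_translates(1) assms unfolding disjoint_family_on_def by blast
  with assms show ?thesis
    using inj_on_image_eq_iff[OF tr_inj_on, of e f q] motif_edge_subset by blast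
qed

lemma bij_betw_vertex_label:
  assumes "bij_betw \<kappa> UNIV F\<^sub>v"
  shows "bij_betw (\<lambda>(j, q). vertex_label tr \<kappa> j q) UNIV (V \<times> UNIV)"
proof -
  have \<kappa>: "\<kappa> l \<in> F\<^sub>v" "inj \<kappa>" "range \<kappa> = F\<^sub>v" for l
    using assms by (auto simp: bij_betw_def)
  have "inj (\<lambda>(j, q). vertex_label tr \<kappa> j q)"
  proof (rule injI, clarify)
    fix l i q l' i' q'
    assume "vertex_label tr \<kappa> (l, i) q = vertex_label tr \<kappa> (l', i') q'"
    then show "(l, i) = (l', i') \<and> q = q'"
      using motif_translate_unique[OF \<kappa>(1) \<kappa>(1), of q l q' l'] injD[OF \<kappa>(2)]
      by (auto simp: vertex_label_def)
  qed
  moreover have "range (\<lambda>(j, q). vertex_label tr \<kappa> j q) = V \<times> UNIV"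
    using vertex_translates(2) \<kappa>(3)
    by (fastforce simp: vertex_label_def image_iff)
  ultimately show ?thesis by (simp add: bij_betw_def)
qed

lemma bij_betw_edge_label:
  assumes "bij_betw \<epsilon> UNIV F\<^sub>e"
  shows "bij_betw (\<lambda>(k, q). edge_label tr \<epsilon> k q) UNIV E"
proof -
  have \<epsilon>: "\<epsilon> k \<in> F\<^sub>e" "inj \<epsilon>" "range \<epsilon> = F\<^sub>e" for k
    using assms by (auto simp: bij_betw_def)
  have "inj (\<lambda>(k, q). edge_label tr \<epsilon> k q)"
  proof (rule injI, clarify)
    fix k q k' q'
    assume "edge_label tr \<epsilon> k q = edge_label tr \<epsilon> k' q'"
    then show "k = k' \<and> q = q'"
      using motif_edge_translate_unique[OF \<epsilon>(1) \<epsilon>(1), of q k q' k'] injD[OF \<epsilon>(2)]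
      by (auto simp: edge_label_def)
  qed
  moreover have "range (\<lambda>(k, q). edge_label tr \<epsilon> k q) = E"
    using edge_translates(2) \<epsilon>(3)
    by (fastforce simp: edge_label_def image_iff)
  ultimately show ?thesis by (simp add: bij_betw_def)
qed

text \<open>
  An edge has two endpoints, and each has only one translation index.
\<close>

lemma finite_motif_incidences:
  assumes "bij_betw \<kappa> UNIV F\<^sub>v" "e \<in> F\<^sub>e"
  shows "finite {q. tr q (\<kappa> l) \<in> e}"
proof -
  have "card e = 2" using assms(2) motif_edges(2) simple_graph by blast
  then have "finite e" by (intro card_ge_0_finite) simp
  moreover have "inj (\<lambda>q. tr q (\<kappa> l))"
  proof (rule injI)
    fix q r assume "tr q (\<kappa> l) = tr r (\<kappa> l)"
    moreover have "\<kappa> l \<in> F\<^sub>v" using assms(1) by (auto simp: bij_betw_def)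
    ultimately show "q = r" using motif_translate_unique by blast
  qed
  ultimately show ?thesis
    using finite_vimageI[of e "\<lambda>q. tr q (\<kappa> l)"] by (simp add: vimage_def)
qed

text \<open>
  Each row of the rigidity matrix only involves the difference of the two joints of an edge, and
  translations leave differences unchanged.
\<close>

lemma rigidity_matrix_translate:
  assumes e: "e \<in> F\<^sub>e" and "v \<in> e"
  shows "rigidity_matrix E p (tr q ` e) (tr q v, i) = rigidity_matrix F\<^sub>e p e (v, i)"
proof -
  have "card e = 2" "e \<subseteq> V" using e motif_edges(2) simple_graph by blast+
  then obtain w where w: "e = {v, w}" "v \<noteq> w"
    using \<open>v \<in> e\<close> by (auto simp: card_2_iff)
  then have V: "v \<in> V" "w \<in> V" using \<open>e \<subseteq> V\<close> by auto
  have neq: "tr q v \<noteq> tr q w" using tr_inj_on[of q] V w(2) by (auto simp: inj_on_def)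
  have "(THE x. {v, w} = {v, x}) = w" "(THE x. {tr q v, tr q w} = {tr q v, x}) = tr q w"
    using w(2) neq by (auto simp: doubleton_eq_iff)
  moreover have "tr q ` e \<in> E" using e motif_edges(2) tr_edge by blast
  ultimately show ?thesis
    using e V w(1) by (simp add: rigidity_matrix_def tr_point)
qed

end

section \<open>The symbol function and the rigidity operator\<close>

locale enumerated_crystal_framework = crystal_framework V E p a tr F\<^sub>v F\<^sub>e
  for V :: "'v set" and E :: "'v set set" and p :: "'v \<Rightarrow> real ^ 'd"
    and a :: "'d \<Rightarrow> real ^ 'd" and tr :: "int ^ 'd \<Rightarrow> 'v \<Rightarrow> 'v"
    and F\<^sub>v :: "'v set" and F\<^sub>e :: "'v set set" +
  fixes \<kappa> :: "'n::finite \<Rightarrow> 'v" and \<epsilon> :: "'m::finite \<Rightarrow> 'v set"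
  assumes \<kappa>: "bij_betw \<kappa> UNIV F\<^sub>v" and \<epsilon>: "bij_betw \<epsilon> UNIV F\<^sub>e"
begin

text \<open>
  The translation indices \<open>r\<close> for which \<open>(\<kappa> (fst j), r)\<close> is an endpoint of the motif edge \<open>\<epsilon> k\<close>. The index \<open>j\<close>
  carries a coordinate direction as well, so that it runs over the columns of the symbol function.
\<close>

definition incidences :: "'m \<Rightarrow> 'n \<times> 'd \<Rightarrow> (int ^ 'd) set" where
  "incidences k j = {r. tr r (\<kappa> (fst j)) \<in> \<epsilon> k}"

definition motif_coeff :: "'m \<Rightarrow> 'n \<times> 'd \<Rightarrow> int ^ 'd \<Rightarrow> complex" where
  "motif_coeff k j r = of_real (rigidity_matrix F\<^sub>e p (\<epsilon> k) (vertex_label tr \<kappa> j r))"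

lemma \<kappa>_in_V: "\<kappa> l \<in> V" and \<epsilon>_in: "\<epsilon> k \<in> F\<^sub>e"
  using \<kappa> \<epsilon> motif_vertex_in_V by (auto simp: bij_betw_def)

lemma finite_incidences: "finite (incidences k j)"
  unfolding incidences_def by (rule finite_motif_incidences[OF \<kappa> \<epsilon>_in])

lemma symbol_function_entry:
  "symbol_function F\<^sub>e p tr \<kappa> \<epsilon> z $ k $ j = (\<Sum>r\<in>incidences k j. motif_coeff k j r * mpowi z (- r))"
  by (simp add: symbol_function_def incidences_def motif_coeff_def)

lemma trig_polynomial_symbol_function:
  "trig_polynomial (\<lambda>z. symbol_function F\<^sub>e p tr \<kappa> \<epsilon> z $ k $ j)"
  unfolding symbol_function_entry by (rule trig_polynomialI[OF finite_incidences refl])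

text \<open>
  The endpoints of the edge \<open>(k, q)\<close> are the vertices \<open>(l, q + r)\<close> for which \<open>(l, r)\<close> is an endpoint of the
  motif edge \<open>k\<close>.
\<close>

lemma rigidity_op_edge_label:
  "rigidity_op E p u (edge_label tr \<epsilon> k q) =
    (\<Sum>j\<in>UNIV. \<Sum>r\<in>incidences k j. motif_coeff k j r * u (vertex_label tr \<kappa> j (q + r)))"
proof -
  have bij: "bij_betw (\<lambda>(j, r). vertex_label tr \<kappa> j (q + r)) (SIGMA j:UNIV. incidences k j)
      (edge_label tr \<epsilon> k q \<times> UNIV)"
  proof (rule bij_betw_imageI)
    have inj: "inj (\<lambda>(j, q). vertex_label tr \<kappa> j q)"
      using bij_betw_vertex_label[OF \<kappa>] by (rule bij_betw_imp_inj_on)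
    show "inj_on (\<lambda>(j, r). vertex_label tr \<kappa> j (q + r)) (SIGMA j:UNIV. incidences k j)"
    proof (rule inj_onI, clarify)
      fix l i r l' i' r'
      assume "vertex_label tr \<kappa> (l, i) (q + r) = vertex_label tr \<kappa> (l', i') (q + r')"
      with injD[OF inj, of "((l, i), q + r)" "((l', i'), q + r')"]
      show "(l, i) = (l', i') \<and> r = r'" by simp
    qed
    show "(\<lambda>(j, r). vertex_label tr \<kappa> j (q + r)) ` (SIGMA j:UNIV. incidences k j) =
        edge_label tr \<epsilon> k q \<times> UNIV"
    proof (intro equalityI subsetI)
      fix x assume "x \<in> (\<lambda>(j, r). vertex_label tr \<kappa> j (q + r)) ` (SIGMA j:UNIV. incidences k j)"
      then show "x \<in> edge_label tr \<epsilon> k q \<times> UNIV"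
        by (auto simp: vertex_label_def edge_label_def incidences_def tr_add \<kappa>_in_V)
    next
      fix x assume "x \<in> edge_label tr \<epsilon> k q \<times> (UNIV :: 'd set)"
      then obtain v i where x: "x = (tr q v, i)" "v \<in> \<epsilon> k"
        by (auto simp: edge_label_def)
      then have "v \<in> V" using motif_edge_subset[OF \<epsilon>_in] by blast
      then obtain r l where v: "v = tr r (\<kappa> l)"
        using vertex_translates(2) \<kappa> by (auto simp: bij_betw_def)
      have "x = vertex_label tr \<kappa> (l, i) (q + r)" "r \<in> incidences k (l, i)"
        using x v by (simp_all add: vertex_label_def incidences_def tr_add \<kappa>_in_V)
      then show "x \<in> (\<lambda>(j, r). vertex_label tr \<kappa> j (q + r)) ` (SIGMA j:UNIV. incidences k j)"
        by force
    qed
  qed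
  have coeff: "of_real (rigidity_matrix E p (edge_label tr \<epsilon> k q) (vertex_label tr \<kappa> j (q + r))) =
      motif_coeff k j r" if "r \<in> incidences k j" for j r
    using that rigidity_matrix_translate[OF \<epsilon>_in, of "tr r (\<kappa> (fst j))" k q "snd j"]
    by (simp add: motif_coeff_def edge_label_def vertex_label_def incidences_def case_prod_unfold
        tr_add \<kappa>_in_V)
  have "rigidity_op E p u (edge_label tr \<epsilon> k q) = (\<Sum>(j, r)\<in>(SIGMA j:UNIV. incidences k j).
      of_real (rigidity_matrix E p (edge_label tr \<epsilon> k q) (vertex_label tr \<kappa> j (q + r))) *
      u (vertex_label tr \<kappa> j (q + r)))"
    unfolding rigidity_op_def
    by (subst sum.reindex_bij_betw[OF bij, symmetric]) (simp add: case_prod_unfold)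
  also have "\<dots> = (\<Sum>j\<in>UNIV. \<Sum>r\<in>incidences k j.
      of_real (rigidity_matrix E p (edge_label tr \<epsilon> k q) (vertex_label tr \<kappa> j (q + r))) *
      u (vertex_label tr \<kappa> j (q + r)))"
    by (simp add: sum.Sigma finite_incidences)
  finally show ?thesis by (simp add: coeff)
qed

text \<open>
  Dually, the edges at the vertex \<open>(l, q)\<close> are the edges \<open>(k, q - r)\<close> for which \<open>(l, r)\<close> is an endpoint of
  the motif edge \<open>k\<close>.
\<close>

lemma rigidity_op_transpose_vertex_label:
  "rigidity_op_transpose E p s (vertex_label tr \<kappa> j q) =
    (\<Sum>k\<in>UNIV. \<Sum>r\<in>incidences k j. motif_coeff k j r * s (edge_label tr \<epsilon> k (q - r)))"
proof -
  obtain l i where j: "j = (l, i)" by (cases j)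
  have bij: "bij_betw (\<lambda>(k, r). edge_label tr \<epsilon> k (q - r)) (SIGMA k:UNIV. incidences k j)
      {e \<in> E. tr q (\<kappa> l) \<in> e}"
  proof (rule bij_betw_imageI)
    have inj: "inj (\<lambda>(k, q). edge_label tr \<epsilon> k q)"
      using bij_betw_edge_label[OF \<epsilon>] by (rule bij_betw_imp_inj_on)
    show "inj_on (\<lambda>(k, r). edge_label tr \<epsilon> k (q - r)) (SIGMA k:UNIV. incidences k j)"
    proof (rule inj_onI, clarify)
      fix k r k' r' assume "edge_label tr \<epsilon> k (q - r) = edge_label tr \<epsilon> k' (q - r')"
      with injD[OF inj, of "(k, q - r)" "(k', q - r')"] show "k = k' \<and> r = r'" by simp
    qed
    show "(\<lambda>(k, r). edge_label tr \<epsilon> k (q - r)) ` (SIGMA k:UNIV. incidences k j) =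
        {e \<in> E. tr q (\<kappa> l) \<in> e}"
    proof (intro equalityI subsetI)
      fix e assume "e \<in> (\<lambda>(k, r). edge_label tr \<epsilon> k (q - r)) ` (SIGMA k:UNIV. incidences k j)"
      then obtain k r where e: "e = tr (q - r) ` \<epsilon> k" "tr r (\<kappa> l) \<in> \<epsilon> k"
        by (auto simp: edge_label_def incidences_def j)
      have "tr q (\<kappa> l) = tr (q - r) (tr r (\<kappa> l))" by (simp flip: tr_add add: \<kappa>_in_V)
      with e show "e \<in> {e \<in> E. tr q (\<kappa> l) \<in> e}"
        using edge_translates(2) \<epsilon>_in by blast
    next
      fix e assume e: "e \<in> {e \<in> E. tr q (\<kappa> l) \<in> e}"
      then obtain k q' where k: "e = tr q' ` \<epsilon> k"
        using edge_translates(2) \<epsilon> by (auto simp: bij_betw_def)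
      then obtain v where v: "v \<in> \<epsilon> k" "tr q (\<kappa> l) = tr q' v" using e by auto
      then have "v \<in> V" using motif_edge_subset[OF \<epsilon>_in] by blast
      have "tr (q - q') (\<kappa> l) = tr (- q') (tr q (\<kappa> l))"
        by (simp flip: tr_add add: \<kappa>_in_V)
      also have "\<dots> = v" using v(2) \<open>v \<in> V\<close> by (simp add: tr_zero flip: tr_add)
      finally have "q - q' \<in> incidences k j" using v(1) by (simp add: incidences_def j)
      moreover have "e = edge_label tr \<epsilon> k (q - (q - q'))" by (simp add: edge_label_def k)
      ultimately show "e \<in> (\<lambda>(k, r). edge_label tr \<epsilon> k (q - r)) ` (SIGMA k:UNIV. incidences k j)"
        by force
    qed
  qed
  have coeff: "of_real (rigidity_matrix E p (edge_label tr \<epsilon> k (q - r)) (vertex_label tr \<kappa> j q)) =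
      motif_coeff k j r" if "r \<in> incidences k j" for k r
  proof -
    have "tr q (\<kappa> l) = tr (q - r) (tr r (\<kappa> l))" by (simp flip: tr_add add: \<kappa>_in_V)
    then show ?thesis
      using that rigidity_matrix_translate[OF \<epsilon>_in, of "tr r (\<kappa> l)" k "q - r" i]
      by (simp add: motif_coeff_def edge_label_def vertex_label_def incidences_def j)
  qed
  have "rigidity_op_transpose E p s (vertex_label tr \<kappa> j q) =
      (\<Sum>e\<in>{e \<in> E. tr q (\<kappa> l) \<in> e}. of_real (rigidity_matrix E p e (vertex_label tr \<kappa> j q)) * s e)"
    by (simp add: rigidity_op_transpose_def vertex_label_def j)
  also have "\<dots> = (\<Sum>(k, r)\<in>(SIGMA k:UNIV. incidences k j).
      of_real (rigidity_matrix E p (edge_label tr \<epsilon> k (q - r)) (vertex_label tr \<kappa> j q)) *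
      s (edge_label tr \<epsilon> k (q - r)))"
    by (subst sum.reindex_bij_betw[OF bij, symmetric]) (simp add: case_prod_unfold)
  also have "\<dots> = (\<Sum>k\<in>UNIV. \<Sum>r\<in>incidences k j.
      of_real (rigidity_matrix E p (edge_label tr \<epsilon> k (q - r)) (vertex_label tr \<kappa> j q)) *
      s (edge_label tr \<epsilon> k (q - r)))"
    by (simp add: sum.Sigma finite_incidences)
  finally show ?thesis by (simp add: coeff)
qed

theorem fourier_map_symbol_function:
  assumes f: "f \<in> L2_torus"
  shows "fourier_map (edge_label tr \<epsilon>) (mult_op (symbol_function F\<^sub>e p tr \<kappa> \<epsilon>) f) =
    rigidity_op E p (fourier_map (vertex_label tr \<kappa>) f)"
proof (rule fourier_map_eqI[OF bij_betw_edge_label[OF \<epsilon>]])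
  show "rigidity_op E p (fourier_map (vertex_label tr \<kappa>) f) e = 0" if "e \<notin> E" for e
    using that by (simp add: rigidity_op_def rigidity_matrix_def case_prod_unfold)
  have inj: "inj (\<lambda>(j, q). vertex_label tr \<kappa> j q)"
    using bij_betw_vertex_label[OF \<kappa>] by (rule bij_betw_imp_inj_on)
  show "fourier_coeff (\<lambda>z. mult_op (symbol_function F\<^sub>e p tr \<kappa> \<epsilon>) f z $ k) q =
      rigidity_op E p (fourier_map (vertex_label tr \<kappa>) f) (edge_label tr \<epsilon> k q)" for k q
    unfolding rigidity_op_edge_label fourier_map_label[OF inj]
    using fourier_coeff_trig_matrix_mult[OF symbol_function_entry f, of k q] by simp
qed

definition adjoint_symbol :: "complex ^ 'd \<Rightarrow> complex ^ 'm ^ ('n \<times> 'd)" where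
  "adjoint_symbol z = (\<chi> j k. cnj (symbol_function F\<^sub>e p tr \<kappa> \<epsilon> z $ k $ j))"

text \<open>
  The coefficients are real and \<open>z\<close> has components of modulus 1, so conjugation only changes the sign of
  the exponents.
\<close>

lemma adjoint_symbol_entry:
  "z \<in> torus \<Longrightarrow>
    adjoint_symbol z $ j $ k = (\<Sum>r\<in>incidences k j. motif_coeff k j r * mpowi z r)"
  by (simp add: adjoint_symbol_def symbol_function_entry cnj_mpowi, simp add: motif_coeff_def)

lemma fourier_map_adjoint_symbol:
  assumes f: "f \<in> L2_torus"
  shows "fourier_map (vertex_label tr \<kappa>) (mult_op adjoint_symbol f) =
    rigidity_op_transpose E p (fourier_map (edge_label tr \<epsilon>) f)"
proof (rule fourier_map_eqI[OF bij_betw_vertex_label[OF \<kappa>]])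
  show "rigidity_op_transpose E p (fourier_map (edge_label tr \<epsilon>) f) x = 0" if "x \<notin> V \<times> UNIV" for x
  proof -
    have "{e \<in> E. fst x \<in> e} = {}" using that simple_graph by (cases x) auto
    then show ?thesis by (simp only: rigidity_op_transpose_def sum.empty)
  qed
  have inj: "inj (\<lambda>(k, q). edge_label tr \<epsilon> k q)"
    using bij_betw_edge_label[OF \<epsilon>] by (rule bij_betw_imp_inj_on)
  show "fourier_coeff (\<lambda>z. mult_op adjoint_symbol f z $ j) q =
      rigidity_op_transpose E p (fourier_map (edge_label tr \<epsilon>) f) (vertex_label tr \<kappa> j q)" for j q
    unfolding rigidity_op_transpose_vertex_label fourier_map_label[OF inj]
    using fourier_coeff_trig_matrix_mult[OF adjoint_symbol_entry f, of j q] by simp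
qed

lemma trig_polynomial_adjoint_symbol: "trig_polynomial (\<lambda>z. adjoint_symbol z $ j $ k)"
  using trig_polynomial_cnj[OF trig_polynomial_symbol_function] by (simp add: adjoint_symbol_def)

end

section \<open>Full rank and vanishing kernels\<close>

text \<open>
  If \<open>x\<close> is in the kernel and \<open>x $ i \<noteq> 0\<close>, then column \<open>i\<close> is a combination of the other columns, which are
  too few to span a space of full dimension.
\<close>

lemma full_column_rank_imp_kernel_trivial:
  fixes A :: "'a::field ^ 'k ^ 'm"
  assumes "column_rank A = CARD('k)" "A *v x = 0"
  shows "x = 0"
proof (rule ccontr)
  assume "x \<noteq> 0"
  then obtain i where i: "x $ i \<noteq> 0" by (auto simp: vec_eq_iff)
  let ?B = "(\<lambda>j. column j A) ` (UNIV - {i})"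
  have "0 = (\<Sum>j\<in>UNIV. x $ j *s column j A)"
    using assms(2) by (simp add: matrix_mult_sum)
  also have "\<dots> = x $ i *s column i A + (\<Sum>j\<in>UNIV - {i}. x $ j *s column j A)"
    by (simp add: sum.remove)
  finally have "x $ i *s column i A = - (\<Sum>j\<in>UNIV - {i}. x $ j *s column j A)"
    by (simp add: eq_neg_iff_add_eq_0)
  moreover have "- (\<Sum>j\<in>UNIV - {i}. x $ j *s column j A) \<in> vec.span ?B"
    by (intro vec.span_neg vec.span_sum vec.span_scale vec.span_base) auto
  ultimately have "inverse (x $ i) *s (x $ i *s column i A) \<in> vec.span ?B"
    by (simp only: vec.span_scale)
  then have "column i A \<in> vec.span ?B"
    using i by (simp add: vector_smult_assoc)
  moreover have "column j A \<in> vec.span ?B" if "j \<noteq> i" for j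
    using that by (intro vec.span_base) auto
  ultimately have "column j A \<in> vec.span ?B" for j
    by (cases "j = i") simp_all
  then have "columns A \<subseteq> vec.span ?B"
    by (auto simp: columns_def)
  then have "vec.dim (columns A) \<le> card ?B"
    by (intro vec.dim_le_card) auto
  also have "\<dots> \<le> card (UNIV - {i})" by (rule card_image_le) simp
  also have "\<dots> < CARD('k)" by (intro psubset_card_mono) auto
  finally show False using assms(1) by (simp add: column_rank_def)
qed

text \<open>
  Conjugating \<open>A\<^sup>* x = 0\<close> gives a kernel vector of the transpose of \<open>A\<close>, whose columns are the rows of \<open>A\<close>.
\<close>

lemma full_row_rank_imp_adjoint_kernel_trivial:
  fixes A :: "complex ^ 'k ^ 'm"
  assumes "row_rank A = CARD('m)" "(\<chi> j k. cnj (A $ k $ j)) *v x = 0"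
  shows "x = 0"
proof -
  have "transpose A *v (\<chi> k. cnj (x $ k)) = 0"
  proof (subst vec_eq_iff, rule allI)
    fix j
    have "(transpose A *v (\<chi> k. cnj (x $ k))) $ j = cnj (((\<chi> j k. cnj (A $ k $ j)) *v x) $ j)"
      unfolding matrix_vector_mult_def transpose_def vec_lambda_beta cnj_sum complex_cnj_mult complex_cnj_cnj ..
    then show "(transpose A *v (\<chi> k. cnj (x $ k))) $ j = 0 $ j"
      by (simp only: assms(2) zero_index complex_cnj_zero)
  qed
  moreover have "column_rank (transpose A) = CARD('m)"
    using assms(1) by (simp add: column_rank_def row_rank_def columns_transpose)
  ultimately have "(\<chi> k. cnj (x $ k)) = 0"
    by (rule full_column_rank_imp_kernel_trivial[rotated])
  then show ?thesis by (simp add: vec_eq_iff)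
qed

context enumerated_crystal_framework
begin

lemma square_summably_rigidI:
  assumes "AE z in haar_torus. column_rank (symbol_function F\<^sub>e p tr \<kappa> \<epsilon> z) = CARD('n \<times> 'd)"
  shows "square_summably_rigid V E p"
proof -
  let ?\<Phi> = "symbol_function F\<^sub>e p tr \<kappa> \<epsilon>"
  note v = bij_betw_vertex_label[OF \<kappa>] and e = bij_betw_edge_label[OF \<epsilon>]
  have "u = (\<lambda>_. 0)" if u: "u \<in> ell2 (V \<times> UNIV)" "rigidity_op E p u = (\<lambda>_. 0)" for u
  proof -
    obtain f where f: "f \<in> L2_torus" "fourier_map (vertex_label tr \<kappa>) f = u"
      using unitary_fourier_map[OF v] u(1) unfolding unitary_L2_ell2_def by blast
    have "mult_op ?\<Phi> f \<in> L2_torus"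
      by (intro mult_op_L2_torus trig_polynomial_symbol_function f)
    moreover have "fourier_map (edge_label tr \<epsilon>) (mult_op ?\<Phi> f) = (\<lambda>_. 0)"
      using fourier_map_symbol_function[OF f(1)] f(2) u(2) by simp
    ultimately have "AE z in haar_torus. mult_op ?\<Phi> f z = 0"
      by (rule fourier_map_eq_0_imp_AE_eq_0[OF e])
    with assms have "AE z in haar_torus. f z = 0"
      by eventually_elim (unfold mult_op_def, rule full_column_rank_imp_kernel_trivial)
    from fourier_map_eq_0_if_AE_eq_0[OF v this] show ?thesis using f(2) by simp
  qed
  moreover have "(\<lambda>_. 0) \<in> ell2 (V \<times> UNIV)" "rigidity_op E p (\<lambda>_. 0) = (\<lambda>_. 0)"
    by (auto simp: ell2_def rigidity_op_def)
  ultimately show ?thesis unfolding square_summably_rigid_def by blast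
qed

lemma square_summably_stress_freeI:
  assumes "AE z in haar_torus. row_rank (symbol_function F\<^sub>e p tr \<kappa> \<epsilon> z) = CARD('m)"
  shows "square_summably_stress_free E p"
proof -
  note v = bij_betw_vertex_label[OF \<kappa>] and e = bij_betw_edge_label[OF \<epsilon>]
  have "s = (\<lambda>_. 0)" if s: "s \<in> ell2 E" "rigidity_op_transpose E p s = (\<lambda>_. 0)" for s
  proof -
    obtain f where f: "f \<in> L2_torus" "fourier_map (edge_label tr \<epsilon>) f = s"
      using unitary_fourier_map[OF e] s(1) unfolding unitary_L2_ell2_def by blast
    have "mult_op adjoint_symbol f \<in> L2_torus"
      by (intro mult_op_L2_torus trig_polynomial_adjoint_symbol f)
    moreover have "fourier_map (vertex_label tr \<kappa>) (mult_op adjoint_symbol f) = (\<lambda>_. 0)"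
      using fourier_map_adjoint_symbol[OF f(1)] f(2) s(2) by simp
    ultimately have "AE z in haar_torus. mult_op adjoint_symbol f z = 0"
      by (rule fourier_map_eq_0_imp_AE_eq_0[OF v])
    with assms have "AE z in haar_torus. f z = 0"
      by eventually_elim
         (unfold mult_op_def adjoint_symbol_def, rule full_row_rank_imp_adjoint_kernel_trivial)
    from fourier_map_eq_0_if_AE_eq_0[OF e this] show ?thesis using f(2) by simp
  qed
  moreover have "(\<lambda>_. 0) \<in> ell2 E" "rigidity_op_transpose E p (\<lambda>_. 0) = (\<lambda>_. 0)"
    by (auto simp: ell2_def rigidity_op_transpose_def)
  ultimately show ?thesis unfolding square_summably_stress_free_def by blast
qed

end

theorem theorem5p2:
  fixes V :: "'v set" and E :: "'v set set" and p :: "'v \<Rightarrow> real ^ 'd"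
    and a :: "'d \<Rightarrow> real ^ 'd" and tr :: "int ^ 'd \<Rightarrow> 'v \<Rightarrow> 'v"
    and F\<^sub>v :: "'v set" and F\<^sub>e :: "'v set set"
    and \<kappa> :: "'n::finite \<Rightarrow> 'v" and \<epsilon> :: "'m::finite \<Rightarrow> 'v set"
    and m n d :: nat
  assumes "crystal_framework V E p a tr F\<^sub>v F\<^sub>e"
    and "bij_betw \<kappa> UNIV F\<^sub>v" and "bij_betw \<epsilon> UNIV F\<^sub>e"
    and "m = card F\<^sub>e" and "n = card F\<^sub>v" and "d = CARD('d)"
  shows "let \<Phi> = symbol_function F\<^sub>e p tr \<kappa> \<epsilon>;
             \<F>\<^sub>v = fourier_map (vertex_label tr \<kappa>);
             \<F>\<^sub>e = fourier_map (edge_label tr \<epsilon>)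
         in
           (\<forall>k j. trig_polynomial (\<lambda>z. \<Phi> z $ k $ j)) \<and>
           unitary_L2_ell2 \<F>\<^sub>v (V \<times> UNIV) \<and> maps_basis (vertex_label tr \<kappa>) \<F>\<^sub>v \<and>
           unitary_L2_ell2 \<F>\<^sub>e E \<and> maps_basis (edge_label tr \<epsilon>) \<F>\<^sub>e \<and>
           (\<forall>f\<in>L2_torus. mult_op \<Phi> f \<in> L2_torus \<and>
              \<F>\<^sub>e (mult_op \<Phi> f) = rigidity_op E p (\<F>\<^sub>v f)) \<and>
           ((AE z in haar_torus. column_rank (\<Phi> z) = d * n) \<longrightarrow> square_summably_rigid V E p) \<and>
           ((AE z in haar_torus. row_rank (\<Phi> z) = m) \<longrightarrow> square_summably_stress_free E p)"
proof -
  interpret enumerated_crystal_framework V E p a tr F\<^sub>v F\<^sub>e \<kappa> \<epsilon>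
    using assms by (simp add: enumerated_crystal_framework_def enumerated_crystal_framework_axioms_def)
  have m: "m = CARD('m)"
    using bij_betw_same_card[OF \<epsilon>] assms by simp
  have dn: "d * n = CARD('n \<times> 'd)"
    using bij_betw_same_card[OF \<kappa>] assms by (simp add: mult.commute)
  note v = bij_betw_vertex_label[OF \<kappa>] and e = bij_betw_edge_label[OF \<epsilon>]
  show ?thesis
    unfolding Let_def m dn
    by (intro conjI allI ballI impI trig_polynomial_symbol_function unitary_fourier_map[OF v]
        unitary_fourier_map[OF e] maps_basis_fourier_map[OF v] maps_basis_fourier_map[OF e]
        mult_op_L2_torus fourier_map_symbol_function square_summably_rigidI
        square_summably_stress_freeI)
qed

end
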